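(* For every $0<\alpha<0.5$ and all sufficiently large $n$, there exists a binary $k$-batch code $[N,n,k]^B$ with redundancy $r=N-n$ such that $$k=\Theta\big((n/\log n)^{0.5-\alpha}\big),\qquad r=\mathcal{O}\big(n^{1-\frac{\alpha}{3}}(\log n)^{\frac{\alpha}{3}}\big).$$ In particular, for $0<\epsilon<0.5$: $r_B\big(n,k=\Omega(n^{\epsilon^-})\big)=\mathcal{O}\big(n^{\delta(\epsilon)^+}\big)$ where $\delta(\epsilon)=\frac56+\frac{\epsilon}{3}$, and $r_B\big(n,k=\Theta(n^\epsilon)\big)=o(n)$. For $\epsilon\ge0.5$, there exists a binary $k$-batch code $[N,n,k]^B$ of dimension $n$ with $k=\Theta(n^\epsilon)$ and $N=\mathcal{O}(n^{0.5+\epsilon^+})$.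
   Context: A binary $[N,n,k]^B$ code ($k$-batch code) is a binary linear code of length $N$ encoding $n$ information bits $x_1,\dots,x_n$ such that for every multiset $\{i_1,\dots,i_k\}$ of indices there exist $k$ mutually disjoint sets $R_1,\dots,R_k\subseteq\{1,\dots,N\}$ such that, for each $j$, $x_{i_j}$ is a function of the codeword bits indexed by $R_j$. Its redundancy is $N-n$; $r_B(n,k)$ is the minimum redundancy of a binary $[N,n,k]^B$ code. Notation: $f(n)=\Omega(n^{a^-})$ means $f(n)=\Omega(n^{a-\tau})$ for all $\tau>0$; $f(n)=\mathcal{O}(n^{a^+})$ means $f(n)=\mathcal{O}(n^{a+\tau})$ for all $\tau>0$; $r_B(n,k=\Omega(n^{\epsilon^-}))=\mathcal{O}(n^{\delta^+})$ means there exist binary $k$-batch codes of dimension $n$ with $k=\Omega(n^{\epsilon^-})$ and redundancy $\mathcal{O}(n^{\delta^+})$. Logarithms are to base 2. *)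

theory Defs
  imports Complex_Main "HOL-Library.Landau_Symbols"
begin

text \<open>A binary linear code of length N with n information bits x_0..x_{n-1}
  is given by its generator matrix, described column-wise: codeword bit t
  (t < N) is the GF(2)-sum of the information bits indexed by S t,
  where S t is a subset of {..<n}.\<close>

definition lin_code :: "nat \<Rightarrow> nat \<Rightarrow> (nat \<Rightarrow> nat set) \<Rightarrow> bool" where
  "lin_code n N S \<longleftrightarrow> (\<forall>t<N. S t \<subseteq> {..<n})"

definition enc :: "(nat \<Rightarrow> nat set) \<Rightarrow> (nat \<Rightarrow> bool) \<Rightarrow> nat \<Rightarrow> bool" where
  "enc S x t = odd (card {i \<in> S t. x i})"

definition recovers :: "(nat \<Rightarrow> nat set) \<Rightarrow> nat set \<Rightarrow> nat \<Rightarrow> bool" where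
  "recovers S R i \<longleftrightarrow>
     (\<exists>g :: (nat \<Rightarrow> bool) \<Rightarrow> bool. \<forall>x. x i = g (\<lambda>t. if t \<in> R then enc S x t else False))"

definition batch_code :: "nat \<Rightarrow> nat \<Rightarrow> nat \<Rightarrow> (nat \<Rightarrow> nat set) \<Rightarrow> bool" where
  "batch_code N n k S \<longleftrightarrow> lin_code n N S \<and>
     (\<forall>is. length is = k \<and> set is \<subseteq> {..<n} \<longrightarrow>
        (\<exists>R :: nat \<Rightarrow> nat set.
           (\<forall>j<k. R j \<subseteq> {..<N}) \<and>
           (\<forall>j<k. \<forall>j'<k. j \<noteq> j' \<longrightarrow> R j \<inter> R j' = {}) \<and>
           (\<forall>j<k. recovers S (R j) (is ! j))))"

definition has_batch_code :: "nat \<Rightarrow> nat \<Rightarrow> nat \<Rightarrow> bool" where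
  "has_batch_code N n k \<longleftrightarrow> (\<exists>S. batch_code N n k S)"

end

theory Submission
  imports Defs "HOL-Library.Function_Algebras" "HOL-Library.Z2"
    "HOL-Algebra.Algebraic_Closure_Type" "HOL-Real_Asymp.Real_Asymp"
begin

text \<open>
  For \<open>\<alpha> < 1/4\<close> the codes are multiplicity codes in four variables over the field \<open>K\<close> with \<open>q = 2 ^ l\<close> elements:
  a polynomial \<open>f\<close> is stored through its derivatives of order below \<open>s + 4\<close> at all points of \<open>K^4\<close>, and the
  information symbols are directional derivatives of order below \<open>s\<close>, each split into \<open>l\<close> bits. Along a line the
  degree of \<open>f\<close> is less than \<open>(s + 4) (q - 1)\<close>, so the \<open>q - 1\<close> points of a line other than \<open>p\<close> determine \<open>f\<close> on it,
  and \<open>s\<close> lines through \<open>p\<close> in a plane containing the direction \<open>v\<close> determine the derivatives at \<open>p\<close> along \<open>v\<close>.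
  Lines through \<open>p\<close> are disjoint off \<open>p\<close>, hence fewer than \<open>q\<^sup>2 (q - s)\<close> used points leave a plane with \<open>s\<close> untouched
  lines; since a recovering set has at most \<open>s (q - 1)\<close> points, \<open>k \<approx> q\<^sup>2 / (2 s)\<close> queries can be served greedily. The
  redundancy is a fraction \<open>O(1 / s)\<close> of the length \<open>\<approx> (s q)^4 log q\<close>.

  For \<open>\<alpha> \<ge> 1/4\<close> it suffices to add to \<open>n\<close> points of \<open>K^3\<close> the parities over the lines with \<open>k\<close> directions on the conic
  \<open>(1, x, x\<^sup>2)\<close>: such a line meets at most one of the lines through a given point, so \<open>k\<close> queries can be served greedily
  with redundancy \<open>k * q\<^sup>2\<close>. For \<open>\<epsilon> \<ge> 1/2\<close> a multiplicity code with \<open>s = 1\<close> is repeated.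
\<close>

section \<open>Batch codes from functionals on an elementary abelian 2-group\<close>

text \<open>A finite vector space over GF(2), given as a subset of an additive group, so that spaces
  whose dimension depends on parameters need no type of their own. Linear functionals are
  truth-valued, as codeword bits are.\<close>

definition xor_group :: "'v::ab_group_add set \<Rightarrow> bool" where
  "xor_group V \<longleftrightarrow> finite V \<and> 0 \<in> V \<and> (\<forall>x\<in>V. \<forall>y\<in>V. x + y \<in> V) \<and> (\<forall>x\<in>V. x + x = 0)"

definition xor_hom :: "'v::ab_group_add set \<Rightarrow> ('v \<Rightarrow> bool) \<Rightarrow> bool" where
  "xor_hom V \<phi> \<longleftrightarrow> (\<forall>x\<in>V. \<forall>y\<in>V. \<phi> (x + y) = (\<phi> x \<noteq> \<phi> y))"

lemma xor_hom_0: "xor_group V \<Longrightarrow> xor_hom V \<phi> \<Longrightarrow> \<not> \<phi> 0"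
  unfolding xor_group_def xor_hom_def by (metis add.right_neutral)

lemma xor_group_sum:
  assumes "xor_group V" "finite A" "\<And>a. a \<in> A \<Longrightarrow> d a \<in> V"
  shows "(\<Sum>a\<in>A. d a) \<in> V"
  using assms(2,3) by (induction A rule: finite_induct) (use assms(1) in \<open>auto simp: xor_group_def\<close>)

lemma xor_hom_sum:
  assumes V: "xor_group V" and \<phi>: "xor_hom V \<phi>" and A: "finite A" and d: "\<And>a. a \<in> A \<Longrightarrow> d a \<in> V"
  shows "\<phi> (\<Sum>a\<in>A. d a) \<longleftrightarrow> odd (card {a \<in> A. \<phi> (d a)})"
  using A d
proof (induction A rule: finite_induct)
  case empty
  then show ?case using xor_hom_0[OF V \<phi>] by simp
next
  case (insert a A)
  have "(\<Sum>a\<in>A. d a) \<in> V" "d a \<in> V"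
    using insert by (auto intro!: xor_group_sum[OF V])
  then have "\<phi> (\<Sum>a\<in>insert a A. d a) \<longleftrightarrow> \<phi> (d a) \<noteq> \<phi> (\<Sum>a\<in>A. d a)"
    using \<phi> insert.hyps by (simp add: xor_hom_def)
  moreover have "{b \<in> insert a A. \<phi> (d b)} = (if \<phi> (d a) then insert a {b \<in> A. \<phi> (d b)} else {b \<in> A. \<phi> (d b)})"
    by auto
  ultimately show ?case
    using insert by simp
qed

lemma xor_group_diff_eq: "xor_group V \<Longrightarrow> x \<in> V \<Longrightarrow> y \<in> V \<Longrightarrow> x + y = 0 \<Longrightarrow> x = y"
  unfolding xor_group_def by (metis add.inverse_inverse add_eq_0_iff)

text \<open>A separating family of minimal cardinality is a basis of the dual: dropping one of its members
  leaves a nonzero common zero, and these zeros form the dual basis.\<close>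

lemma xor_dual_basis:
  assumes V: "xor_group V"
    and hom: "\<And>\<phi>. \<phi> \<in> \<Lambda> \<Longrightarrow> xor_hom V \<phi>"
    and sep: "\<And>x. x \<in> V \<Longrightarrow> x \<noteq> 0 \<Longrightarrow> \<exists>\<phi>\<in>\<Lambda>. \<phi> x"
  obtains B d where "finite B" "B \<subseteq> \<Lambda>" "card V = 2 ^ card B"
    "\<And>\<phi>. \<phi> \<in> B \<Longrightarrow> d \<phi> \<in> V" "\<And>\<phi> \<psi>. \<phi> \<in> B \<Longrightarrow> \<psi> \<in> B \<Longrightarrow> \<phi> (d \<psi>) \<longleftrightarrow> \<phi> = \<psi>"
    "\<forall>x\<in>V. (\<forall>\<phi>\<in>B. \<not> \<phi> x) \<longrightarrow> x = 0"
proof -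
  define sepd where "sepd B \<longleftrightarrow> finite B \<and> B \<subseteq> \<Lambda> \<and> (\<forall>x\<in>V. x \<noteq> 0 \<longrightarrow> (\<exists>\<phi>\<in>B. \<phi> x))" for B
  obtain c where c: "\<And>x. x \<in> V \<Longrightarrow> x \<noteq> 0 \<Longrightarrow> c x \<in> \<Lambda> \<and> c x x"
    using sep by metis
  have "sepd (c ` (V - {0}))"
    using c V by (auto simp: sepd_def xor_group_def)
  then obtain B where B: "sepd B" and min: "\<And>B'. sepd B' \<Longrightarrow> card B \<le> card B'"
    using ex_has_least_nat[of sepd "c ` (V - {0})" card] by blast
  have fin: "finite B" and sub: "B \<subseteq> \<Lambda>" and B_sep: "\<And>x. x \<in> V \<Longrightarrow> x \<noteq> 0 \<Longrightarrow> \<exists>\<phi>\<in>B. \<phi> x"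
    using B by (auto simp: sepd_def)
  have homB: "xor_hom V \<phi>" if "\<phi> \<in> B" for \<phi>
    using that sub hom by auto
  have "\<exists>x\<in>V. \<forall>\<psi>\<in>B. \<psi> x \<longleftrightarrow> \<psi> = \<phi>" if \<phi>: "\<phi> \<in> B" for \<phi>
  proof -
    have "\<not> sepd (B - {\<phi>})"
      using min[of "B - {\<phi>}"] \<phi> fin by (metis card_Diff1_less not_le)
    then have "\<exists>x\<in>V. x \<noteq> 0 \<and> (\<forall>\<psi>\<in>B - {\<phi>}. \<not> \<psi> x)"
      using fin sub unfolding sepd_def by blast
    then obtain x where x: "x \<in> V" "x \<noteq> 0" "\<forall>\<psi>\<in>B - {\<phi>}. \<not> \<psi> x"
      by blast
    obtain \<chi> where "\<chi> \<in> B" "\<chi> x"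
      using B_sep[OF x(1,2)] by blast
    then have "\<forall>\<psi>\<in>B. \<psi> x \<longleftrightarrow> \<psi> = \<phi>"
      using x(3) by (metis Diff_iff singletonD)
    then show ?thesis
      using x(1) by blast
  qed
  then obtain d where dV: "\<And>\<phi>. \<phi> \<in> B \<Longrightarrow> d \<phi> \<in> V"
    and d: "\<And>\<psi> \<phi>. \<psi> \<in> B \<Longrightarrow> \<phi> \<in> B \<Longrightarrow> \<psi> (d \<phi>) \<longleftrightarrow> \<psi> = \<phi>"
    by metis
  \<comment> \<open>An element is identified with the set of its nonzero coordinates: injective by
    separation applied to \<open>x + y\<close>, surjective by sums of dual basis vectors.\<close>
  have "bij_betw (\<lambda>x. {\<phi> \<in> B. \<phi> x}) V (Pow B)"
  proof (rule bij_betwI')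
    fix x y assume xy: "x \<in> V" "y \<in> V"
    have "x = y" if eq: "{\<phi> \<in> B. \<phi> x} = {\<phi> \<in> B. \<phi> y}"
    proof -
      have "\<not> \<phi> (x + y)" if "\<phi> \<in> B" for \<phi>
        using homB[OF that] xy eq that by (auto simp: xor_hom_def)
      then show ?thesis
        using B_sep[of "x + y"] xor_group_diff_eq[OF V xy] xy V by (metis xor_group_def)
    qed
    then show "({\<phi> \<in> B. \<phi> x} = {\<phi> \<in> B. \<phi> y}) = (x = y)" by blast
  next
    fix Y assume Y: "Y \<in> Pow B"
    then have "(\<Sum>\<phi>\<in>Y. d \<phi>) \<in> V"
      using dV fin by (intro xor_group_sum[OF V]) (auto intro: finite_subset)
    moreover have "\<psi> (\<Sum>\<phi>\<in>Y. d \<phi>) \<longleftrightarrow> \<psi> \<in> Y" if "\<psi> \<in> B" for \<psi>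
    proof -
      have "{\<phi> \<in> Y. \<psi> (d \<phi>)} = (if \<psi> \<in> Y then {\<psi>} else {})"
        using Y d that by auto
      moreover have "\<psi> (\<Sum>\<phi>\<in>Y. d \<phi>) \<longleftrightarrow> odd (card {\<phi> \<in> Y. \<psi> (d \<phi>)})"
        using Y fin dV that by (intro xor_hom_sum[OF V homB]) (auto intro: finite_subset)
      ultimately show ?thesis by simp
    qed
    ultimately show "\<exists>x\<in>V. Y = {\<phi> \<in> B. \<phi> x}"
      using Y by blast
  qed auto
  then have card: "card V = 2 ^ card B"
    by (simp add: bij_betw_same_card card_Pow fin)
  have sep0: "\<forall>x\<in>V. (\<forall>\<phi>\<in>B. \<not> \<phi> x) \<longrightarrow> x = 0"
  proof (intro ballI impI, rule ccontr)
    fix x assume "x \<in> V" "\<forall>\<phi>\<in>B. \<not> \<phi> x" "x \<noteq> 0"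
    then show False using B_sep[of x] by blast
  qed
  show ?thesis
    by (rule that[OF fin sub card dV d sep0])
qed

text \<open>This eliminates the decoding function, so that for a linear code recovery can be checked
  on the sum of two messages with equal views.\<close>

lemma recovers_iff:
  "recovers S R i \<longleftrightarrow> (\<forall>x y. (\<forall>t\<in>R. enc S x t = enc S y t) \<longrightarrow> x i = y i)"
proof
  assume "recovers S R i"
  then obtain g where g: "\<And>x. x i = g (\<lambda>t. if t \<in> R then enc S x t else False)"
    unfolding recovers_def by blast
  show "\<forall>x y. (\<forall>t\<in>R. enc S x t = enc S y t) \<longrightarrow> x i = y i"
  proof (intro allI impI)
    fix x y assume "\<forall>t\<in>R. enc S x t = enc S y t"
    then have "(\<lambda>t. if t \<in> R then enc S x t else False) = (\<lambda>t. if t \<in> R then enc S y t else False)"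
      by auto
    then show "x i = y i" using g[of x] g[of y] by simp
  qed
next
  assume *: "\<forall>x y. (\<forall>t\<in>R. enc S x t = enc S y t) \<longrightarrow> x i = y i"
  let ?r = "\<lambda>x t. if t \<in> R then enc S x t else False"
  \<comment> \<open>The decoder asks whether some message with the observed view has bit
    \<open>i\<close> set; all such messages agree there.\<close>
  have "x i = (\<exists>y. ?r y = ?r x \<and> y i)" for x
    using * by (metis (mono_tags, lifting))
  then show "recovers S R i"
    unfolding recovers_def by (intro exI[of _ "\<lambda>z. \<exists>y. ?r y = z \<and> y i"]) blast
qed

text \<open>The messages form an abstract group \<open>V\<close>; the information bits are a basis chosen from \<open>\<Lambda>\<close>,
  so that every query is answered by recovering a member of \<open>\<Lambda>\<close>.\<close>

theorem batch_code_from_functionals: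
  fixes V :: "'v::ab_group_add set"
  assumes V: "xor_group V" and card: "card V = 2 ^ n"
    and hom: "\<And>\<phi>. \<phi> \<in> \<Lambda> \<Longrightarrow> xor_hom V \<phi>"
    and sep: "\<And>x. x \<in> V \<Longrightarrow> x \<noteq> 0 \<Longrightarrow> \<exists>\<phi>\<in>\<Lambda>. \<phi> x"
    and T: "finite T" "\<And>t. t \<in> T \<Longrightarrow> xor_hom V (\<Phi> t)"
    and rec: "\<And>qs. length qs = k \<Longrightarrow> set qs \<subseteq> \<Lambda> \<Longrightarrow>
      \<exists>R. (\<forall>j<k. R j \<subseteq> T) \<and> (\<forall>j<k. \<forall>j'<k. j \<noteq> j' \<longrightarrow> R j \<inter> R j' = {}) \<and>
        (\<forall>j<k. \<forall>x\<in>V. (\<forall>t\<in>R j. \<not> \<Phi> t x) \<longrightarrow> \<not> (qs ! j) x)"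
  shows "has_batch_code (card T) n k"
proof -
  obtain B d where B: "finite B" "B \<subseteq> \<Lambda>" "card V = 2 ^ card B"
    and dV: "\<And>\<phi>. \<phi> \<in> B \<Longrightarrow> d \<phi> \<in> V"
    and d: "\<And>\<phi> \<psi>. \<phi> \<in> B \<Longrightarrow> \<psi> \<in> B \<Longrightarrow> \<phi> (d \<psi>) \<longleftrightarrow> \<phi> = \<psi>"
    by (rule xor_dual_basis[OF V hom sep]) blast+
  have n: "n = card B"
    using card B(3) by simp
  obtain b where b: "bij_betw b {..<n} B"
    using ex_bij_betw_nat_finite[OF B(1)] by (auto simp: n atLeast0LessThan)
  obtain e where e: "bij_betw e {..<card T} T"
    using ex_bij_betw_nat_finite[OF T(1)] by (auto simp: atLeast0LessThan)
  have bB: "b i \<in> B" if "i < n" for i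
    using b that by (auto simp: bij_betw_def)
  define v where "v x = (\<Sum>i\<in>{i. i < n \<and> x i}. d (b i))" for x
  have vV: "v x \<in> V" for x
    unfolding v_def using bB dV by (intro xor_group_sum[OF V]) auto
  define S where "S t = {i. i < n \<and> \<Phi> (e t) (d (b i))}" for t
  have enc: "enc S x t = \<Phi> (e t) (v x)" if "t < card T" for x t
  proof -
    have "\<Phi> (e t) (v x) = odd (card {i \<in> {i. i < n \<and> x i}. \<Phi> (e t) (d (b i))})"
      unfolding v_def using that e bB dV
      by (intro xor_hom_sum[OF V T(2)]) (auto simp: bij_betw_def)
    then show ?thesis
      by (simp add: enc_def S_def conj_ac cong: conj_cong)
  qed
  have val: "b i (v x) = x i" if i: "i < n" for x i
  proof -
    have "b i (v x) = odd (card {j \<in> {j. j < n \<and> x j}. b i (d (b j))})"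
      unfolding v_def using bB dV B(2) hom i
      by (intro xor_hom_sum[OF V]) auto
    moreover have "b i (d (b j)) \<longleftrightarrow> j = i" if "j < n" for j
      using d[OF bB[OF i] bB[OF that]] bij_betw_imp_inj_on[OF b] i that
      by (metis inj_on_eq_iff lessThan_iff)
    then have "{j \<in> {j. j < n \<and> x j}. b i (d (b j))} = (if x i then {i} else {})"
      using i by (auto simp: set_eq_iff cong: conj_cong)
    ultimately show ?thesis by simp
  qed
  have "batch_code (card T) n k S"
    unfolding batch_code_def
  proof (intro conjI allI impI)
    show "lin_code n (card T) S"
      by (auto simp: lin_code_def S_def)
  next
    fix "is" :: "nat list" assume "is": "length is = k \<and> set is \<subseteq> {..<n}"
    have "length (map b is) = k" "set (map b is) \<subseteq> \<Lambda>"
      using "is" bB B(2) by auto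
    from rec[OF this] obtain R where R': "\<forall>j<k. R j \<subseteq> T"
      "\<forall>j<k. \<forall>j'<k. j \<noteq> j' \<longrightarrow> R j \<inter> R j' = {}"
      "\<forall>j<k. \<forall>x\<in>V. (\<forall>t\<in>R j. \<not> \<Phi> t x) \<longrightarrow> \<not> (map b is ! j) x"
      by (elim exE conjE) (rule that)
    note R = R'(1)[rule_format] R'(2)[rule_format] R'(3)[rule_format]
    define R' where "R' j = {t. t < card T \<and> e t \<in> R j}" for j
    have rec': "recovers S (R' j) (is ! j)" if j: "j < k" for j
      unfolding recovers_iff
    proof (intro allI impI)
      fix x y assume eq: "\<forall>t\<in>R' j. enc S x t = enc S y t"
      have i: "is ! j < n"
        using "is" j by (metis lessThan_iff nth_mem subsetD)
      have sum: "v x + v y \<in> V"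
        using vV V by (auto simp: xor_group_def)
      \<comment> \<open>Equal views of \<open>x\<close> and \<open>y\<close> mean that every
        functional read vanishes on \<open>v x + v y\<close>, their difference in characteristic
        2.\<close>
      have zero: "\<not> \<Phi> t (v x + v y)" if "t \<in> R j" for t
      proof -
        have "t \<in> T"
          using subsetD[OF R(1)[OF j] that] .
        then obtain t' where t': "t' < card T" "e t' = t"
          using bij_betw_imp_surj_on[OF e] by (metis imageE lessThan_iff)
        then have "t' \<in> R' j" using that by (simp add: R'_def)
        then have "\<Phi> t (v x) = \<Phi> t (v y)"
          using eq enc[OF t'(1)] t' by metis
        then show ?thesis
          using T(2)[OF \<open>t \<in> T\<close>] vV by (auto simp: xor_hom_def)
      qed
      have "\<not> (map b is ! j) (v x + v y)"
        by (rule R(3)[OF j sum zero])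
      then have "\<not> b (is ! j) (v x + v y)"
        using "is" j by simp
      moreover have "xor_hom V (b (is ! j))"
        using hom bB[OF i] B(2) by auto
      ultimately have "b (is ! j) (v x) = b (is ! j) (v y)"
        using vV by (auto simp: xor_hom_def)
      then show "x (is ! j) = y (is ! j)"
        using val[OF i] by simp
    qed
    have "R' j \<inter> R' j' = {}" if "j < k" "j' < k" "j \<noteq> j'" for j j'
      using R(2)[OF that] by (auto simp: R'_def)
    then show "\<exists>R. (\<forall>j<k. R j \<subseteq> {..<card T}) \<and> (\<forall>j<k. \<forall>j'<k. j \<noteq> j' \<longrightarrow> R j \<inter> R j' = {}) \<and>
        (\<forall>j<k. recovers S (R j) (is ! j))"
      using rec' by (intro exI[of _ R']) (auto simp: R'_def)
  qed
  then show ?thesis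
    by (auto simp: has_batch_code_def)
qed

text \<open>At most \<open>k - 1\<close> earlier sets of at most \<open>D\<close> points are in use.
  As \<open>D > 0\<close>, these are strictly fewer than \<open>k * D\<close> points, so the
  hypothesis yields a disjoint set for the next query.\<close>

lemma greedy_disjoint_choice:
  assumes step: "\<And>q Z. q \<in> \<Lambda> \<Longrightarrow> finite Z \<Longrightarrow> card Z < k * D \<Longrightarrow>
      \<exists>R. P q R \<and> R \<subseteq> T \<and> R \<inter> Z = {} \<and> finite R \<and> card R \<le> D"
    and "length qs \<le> k" "set qs \<subseteq> \<Lambda>" "D > 0"
  shows "\<exists>R. (\<forall>j<length qs. P (qs ! j) (R j) \<and> R j \<subseteq> T \<and> finite (R j) \<and> card (R j) \<le> D) \<and>
    (\<forall>j<length qs. \<forall>j'<length qs. j \<noteq> j' \<longrightarrow> R j \<inter> R j' = {})"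
  using assms(2,3)
proof (induction qs rule: rev_induct)
  case Nil
  then show ?case by simp
next
  case (snoc q qs)
  then have "length qs \<le> k" "set qs \<subseteq> \<Lambda>" by auto
  from snoc.IH[OF this] obtain R where
    "\<forall>j<length qs. P (qs ! j) (R j) \<and> R j \<subseteq> T \<and> finite (R j) \<and> card (R j) \<le> D"
    "\<forall>j<length qs. \<forall>j'<length qs. j \<noteq> j' \<longrightarrow> R j \<inter> R j' = {}"
    by (elim exE conjE) (rule that)
  note R = this[rule_format]
  define Z where "Z = (\<Union>j<length qs. R j)"
  have "card Z \<le> (\<Sum>j<length qs. card (R j))"
    unfolding Z_def by (rule card_UN_le) simp
  also have "\<dots> \<le> length qs * D"
    using R(1) sum_bounded_above[of "{..<length qs}" "\<lambda>j. card (R j)" D] by simp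
  also have "\<dots> < k * D"
    using snoc.prems \<open>D > 0\<close> by simp
  finally have "card Z < k * D" .
  moreover have "finite Z"
    using R(1) by (simp add: Z_def)
  ultimately obtain R0 where R0: "P q R0" "R0 \<subseteq> T" "R0 \<inter> Z = {}" "finite R0" "card R0 \<le> D"
    using step[of q Z] snoc.prems by auto
  have dj: "R0 \<inter> R j = {}" "R j \<inter> R0 = {}" if "j < length qs" for j
    using R0(3) that by (auto simp: Z_def)
  let ?R = "R(length qs := R0)"
  have "P ((qs @ [q]) ! j) (?R j) \<and> ?R j \<subseteq> T \<and> finite (?R j) \<and> card (?R j) \<le> D"
    if "j < length (qs @ [q])" for j
    using R(1)[of j] R0 that by (auto simp: nth_append less_Suc_eq)
  moreover have "?R j \<inter> ?R j' = {}" if "j < length (qs @ [q])" "j' < length (qs @ [q])" "j \<noteq> j'" for j j'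
    using R(2)[of j j'] dj that by (auto simp: less_Suc_eq)
  ultimately show ?case by blast
qed

section \<open>The field with \<open>2 ^ l\<close> elements\<close>

text \<open>The field size varies with \<open>l\<close>, which a type cannot do; \<open>K\<close> is
  therefore the fixed set of the \<open>l\<close>-th iterate of the Frobenius map inside one ambient
  field.\<close>

locale binary_field =
  fixes K :: "'a::field set" and l :: nat
  assumes CHAR_2: "CHAR('a) = 2" and l_pos: "l > 0"
    and K_eq: "K = {x. x ^ 2 ^ l = x}" and card_K: "card K = 2 ^ l"
begin

lemma frobenius_add: "(x + y :: 'a) ^ 2 ^ m = x ^ 2 ^ m + y ^ 2 ^ m"
  by (rule freshmans_dream'[where n = m]) (simp_all add: CHAR_2)

lemma frobenius_sum: "(\<Sum>i\<in>A. f i :: 'a) ^ 2 ^ m = (\<Sum>i\<in>A. f i ^ 2 ^ m)"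
  by (rule freshmans_dream_sum'[where n = m]) (simp_all add: CHAR_2)

lemma frobenius_add_poly: "(p + r :: 'a poly) ^ 2 ^ m = p ^ 2 ^ m + r ^ 2 ^ m"
  by (rule freshmans_dream'[where n = m]) (simp_all add: CHAR_2)

lemma add_self [simp]: "(x :: 'a) + x = 0"
  by (metis CHAR_2 mult_2 mult_zero_left of_nat_CHAR of_nat_numeral)

lemma K_0 [simp]: "0 \<in> K" and K_1 [simp]: "1 \<in> K"
  by (auto simp: K_eq)

lemma K_add: "x \<in> K \<Longrightarrow> y \<in> K \<Longrightarrow> x + y \<in> K"
  by (simp add: K_eq frobenius_add)

lemma K_mult: "x \<in> K \<Longrightarrow> y \<in> K \<Longrightarrow> x * y \<in> K"
  by (simp add: K_eq power_mult_distrib)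

lemma K_uminus: "x \<in> K \<Longrightarrow> - x \<in> K"
  by (metis add_self neg_eq_iff_add_eq_0)

lemma K_diff: "x \<in> K \<Longrightarrow> y \<in> K \<Longrightarrow> x - y \<in> K"
  using K_add[of x "- y"] K_uminus[of y] by simp

lemma K_divide: "x \<in> K \<Longrightarrow> y \<in> K \<Longrightarrow> x / y \<in> K"
  by (simp add: K_eq power_divide)

lemma K_power: "x \<in> K \<Longrightarrow> x ^ n \<in> K"
  by (induction n) (auto intro: K_mult)

lemma K_sum: "(\<And>a. a \<in> A \<Longrightarrow> f a \<in> K) \<Longrightarrow> (\<Sum>a\<in>A. f a) \<in> K"
  by (induction A rule: infinite_finite_induct) (auto intro: K_add)

lemma K_prod: "(\<And>a. a \<in> A \<Longrightarrow> f a \<in> K) \<Longrightarrow> (\<Prod>a\<in>A. f a) \<in> K"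
  by (induction A rule: infinite_finite_induct) (auto intro: K_mult)

lemma finite_K: "finite K"
  using card_K by (metis card.infinite power_not_zero zero_neq_numeral)

lemma xor_group_K: "xor_group K"
  by (auto simp: xor_group_def finite_K K_add)

text \<open>The functionals are \<open>Tr (a * x)\<close> for \<open>a\<close> in \<open>K\<close>:
  the trace takes values 0 and 1, is not identically zero on \<open>K\<close>, and a suitable
  \<open>a\<close> moves a given nonzero \<open>x\<close> to an element of nonzero trace.\<close>

lemma ex_trace_functionals:
  obtains \<Lambda> where "\<And>\<phi>. \<phi> \<in> \<Lambda> \<Longrightarrow> xor_hom K \<phi>" "\<And>x. x \<in> K \<Longrightarrow> x \<noteq> 0 \<Longrightarrow> \<exists>\<phi>\<in>\<Lambda>. \<phi> x"
proof -
  define Tr where "Tr x = (\<Sum>i<l. x ^ 2 ^ i)" for x :: 'a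
  have Tr_add: "Tr (x + y) = Tr x + Tr y" for x y
    by (simp add: Tr_def frobenius_add sum.distrib)
  have Tr_01: "Tr x \<in> {0, 1}" if x: "x \<in> K" for x
  proof -
    \<comment> \<open>Squaring shifts the conjugates of \<open>x\<close> cyclically, so the trace
      equals its own square.\<close>
    have "Tr x ^ 2 = (\<Sum>i<l. x ^ 2 ^ Suc i)"
      unfolding Tr_def using frobenius_sum[of "\<lambda>i. x ^ 2 ^ i" "{..<l}" 1]
      by (simp add: power_mult[symmetric] mult.commute)
    also have "\<dots> = (\<Sum>i<Suc l. x ^ 2 ^ i) - x ^ 2 ^ 0"
      by (subst sum.lessThan_Suc_shift) simp
    also have "\<dots> = Tr x"
      using x by (simp add: Tr_def K_eq)
    finally have "Tr x * (Tr x - 1) = 0"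
      by (simp add: power2_eq_square algebra_simps)
    then show ?thesis by auto
  qed
  have "\<exists>x\<in>K. Tr x \<noteq> 0"
  proof (rule ccontr)
    assume "\<not> (\<exists>x\<in>K. Tr x \<noteq> 0)"
    then have zero: "Tr x = 0" if "x \<in> K" for x using that by blast
    define p :: "'a poly" where "p = (\<Sum>i<l. monom 1 (2 ^ i))"
    \<comment> \<open>The trace polynomial has degree at most \<open>2 ^ (l - 1)\<close>, too small
      for all of \<open>K\<close> to be roots; its linear term shows that it is nonzero.\<close>
    have "coeff p 1 = (\<Sum>i<l. if i = 0 then 1 else 0)"
      unfolding p_def coeff_sum by (intro sum.cong) (auto simp: coeff_monom)
    then have "p \<noteq> 0"
      using l_pos by (auto simp: sum.delta)
    have "degree p \<le> 2 ^ (l - 1)"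
      unfolding p_def
      by (intro degree_sum_le) (auto intro!: order.trans[OF degree_monom_le])
    have "K \<subseteq> {x. poly p x = 0}"
      using zero by (auto simp: p_def Tr_def poly_sum poly_monom)
    then have "card K \<le> card {x. poly p x = 0}"
      by (intro card_mono poly_roots_finite \<open>p \<noteq> 0\<close>)
    also have "\<dots> \<le> degree p"
      by (rule card_poly_roots_bound[OF \<open>p \<noteq> 0\<close>])
    also have "\<dots> \<le> 2 ^ (l - 1)" by fact
    also have "\<dots> < 2 ^ l" using l_pos by simp
    finally show False using card_K by simp
  qed
  then obtain x0 where x0: "x0 \<in> K" "Tr x0 \<noteq> 0" by blast
  show ?thesis
  proof (rule that[of "{\<lambda>x. Tr (a * x) \<noteq> 0 |a. a \<in> K}"])
    fix \<phi> assume "\<phi> \<in> {\<lambda>x. Tr (a * x) \<noteq> 0 |a. a \<in> K}"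
    then obtain a where a: "a \<in> K" "\<phi> = (\<lambda>x. Tr (a * x) \<noteq> 0)" by blast
    have "(Tr (a * (x + y)) \<noteq> 0) = ((Tr (a * x) \<noteq> 0) \<noteq> (Tr (a * y) \<noteq> 0))" if "x \<in> K" "y \<in> K" for x y
      using Tr_01[OF K_mult[OF a(1) that(1)]] Tr_01[OF K_mult[OF a(1) that(2)]]
      by (auto simp: distrib_left Tr_add)
    then show "xor_hom K \<phi>"
      by (simp add: xor_hom_def a(2))
  next
    fix x assume "x \<in> K" "x \<noteq> 0"
    then have "Tr (x0 / x * x) \<noteq> 0" "x0 / x \<in> K"
      using x0 by (auto intro: K_divide)
    then show "\<exists>\<phi>\<in>{\<lambda>x. Tr (a * x) \<noteq> 0 |a. a \<in> K}. \<phi> x"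
      by (intro bexI[of _ "\<lambda>y. Tr (x0 / x * y) \<noteq> 0"] CollectI exI[of _ "x0 / x"] conjI refl)
  qed
qed

text \<open>These are coordinates of \<open>K\<close> over GF(2), used to split each field symbol
  into bits; there are exactly \<open>l\<close> because \<open>K\<close> has \<open>2 ^ l\<close>
  elements.\<close>

lemma ex_bit_functionals:
  obtains B where "finite B" "card B = l" "\<forall>\<phi>\<in>B. xor_hom K \<phi>"
    "\<forall>x\<in>K. (\<forall>\<phi>\<in>B. \<not> \<phi> x) \<longrightarrow> x = 0"
proof -
  obtain \<Lambda> where L: "\<And>\<phi>. \<phi> \<in> \<Lambda> \<Longrightarrow> xor_hom K \<phi>" "\<And>x. x \<in> K \<Longrightarrow> x \<noteq> 0 \<Longrightarrow> \<exists>\<phi>\<in>\<Lambda>. \<phi> x"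
    by (rule ex_trace_functionals) (rule that)
  obtain B where B: "finite B" "B \<subseteq> \<Lambda>" "card K = 2 ^ card B"
    "\<forall>x\<in>K. (\<forall>\<phi>\<in>B. \<not> \<phi> x) \<longrightarrow> x = 0"
    by (rule xor_dual_basis[OF xor_group_K L]) (assumption, assumption, assumption, rule that)
  show ?thesis
    by (rule that[OF B(1) _ _ B(4)]) (use B(2,3) L(1) card_K in auto)
qed

end

text \<open>Over an algebraically closed field \<open>X^q - X\<close> splits into linear factors,
  and its derivative is the constant -1 because \<open>q = 0\<close> there, so no root is
  repeated.\<close>

lemma card_frobenius_fixed:
  assumes "CHAR('a::alg_closed_field) = 2" "l > 0"
  shows "card {x::'a. x ^ 2 ^ l = x} = 2 ^ l"
proof -
  define q :: nat where "q = 2 ^ l"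
  have q: "q > 1" using one_less_power[of "2::nat" l] \<open>l > 0\<close> by (simp add: q_def)
  define p :: "'a poly" where "p = monom 1 q - monom 1 1"
  have deg: "degree p = q"
    unfolding p_def diff_conv_add_uminus using q by (subst degree_add_eq_left) (auto simp: degree_monom_eq)
  have "p \<noteq> 0" using deg q by auto
  have "of_nat q = (0::'a)"
    unfolding of_nat_eq_0_iff_char_dvd using assms by (simp add: q_def)
  then have pd: "pderiv p = - 1"
    by (simp add: p_def pderiv_diff pderiv_monom one_pCons monom_0)
  obtain A where A: "size A = q" "p = smult (lead_coeff p) (\<Prod>x\<in>#A. [:-x, 1:])"
    using alg_closed_imp_factorization[OF \<open>p \<noteq> 0\<close>] deg by metis
  have lc: "lead_coeff p \<noteq> 0" using \<open>p \<noteq> 0\<close> by simp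
  have roots: "{x. poly p x = 0} = set_mset A"
    by (subst A(2)) (use lc in \<open>auto simp: poly_prod_mset prod_mset_zero_iff\<close>)
  have "count A x \<le> 1" for x
  proof (rule ccontr)
    assume "\<not> count A x \<le> 1"
    then have "{#x, x#} \<subseteq># A"
      by (simp add: subseteq_mset_def)
    then obtain A' where A': "A = {#x, x#} + A'"
      unfolding subset_mset.le_iff_add by blast
    define r where "r = smult (lead_coeff p) (\<Prod>x\<in>#A'. [:-x, 1:])"
    have r: "p = [:-x, 1:] * ([:-x, 1:] * r)"
      unfolding r_def by (subst A(2)) (simp only: A', simp)
    have "poly (pderiv p) x = 0"
      by (subst r, subst pderiv_mult) simp
    then show False using pd by simp
  qed
  then have "count A x = 1" if "x \<in># A" for x
    using that by (metis count_greater_eq_one_iff le_antisym)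
  then have "card (set_mset A) = size A"
    by (simp add: size_multiset_overloaded_eq)
  then show ?thesis
    using roots A(1) by (simp add: p_def poly_monom q_def)
qed

lemma CHAR_bit: "CHAR(bit) = 2"
proof (rule CHAR_eqI)
  fix n assume n: "of_nat n = (0 :: bit)"
  show "2 dvd n"
  proof (rule ccontr)
    assume "\<not> 2 dvd n"
    then obtain k where "n = 2 * k + 1" by (elim oddE)
    then have "of_nat n = (2 * of_nat k + 1 :: bit)" by simp
    also have "\<dots> = 1" by (simp only: bit_2_eq_0 mult_zero_left add_0)
    finally show False using n by simp
  qed
qed simp

lemma ex_binary_field:
  assumes "l > 0"
  shows "binary_field {x::bit alg_closure. x ^ 2 ^ l = x} l"
  using assms by unfold_locales (simp_all add: CHAR_bit card_frobenius_fixed)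

section \<open>Restrictions to lines and jets of multivariate polynomials\<close>

text \<open>With \<open>f = (\<Sum>x\<in>I. c x * (\<Prod>j<m. H x j (X\<^sub>j)))\<close>, \<open>line_restr\<close> is the univariate polynomial \<open>f (p + T w)\<close>
  and \<open>jet\<close> is the Hasse derivative of \<open>f\<close> of multi-order \<open>t\<close> at \<open>y\<close>.\<close>

definition line_restr ::
    "nat \<Rightarrow> 'x set \<Rightarrow> ('x \<Rightarrow> nat \<Rightarrow> 'a::field poly) \<Rightarrow> ('x \<Rightarrow> 'a) \<Rightarrow> (nat \<Rightarrow> 'a) \<Rightarrow> (nat \<Rightarrow> 'a) \<Rightarrow> 'a poly" where
  "line_restr m I H c p w = (\<Sum>x\<in>I. smult (c x) (\<Prod>j<m. pcompose (H x j) [:p j, w j:]))"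

definition jet ::
    "nat \<Rightarrow> 'x set \<Rightarrow> ('x \<Rightarrow> nat \<Rightarrow> 'a::field poly) \<Rightarrow> ('x \<Rightarrow> 'a) \<Rightarrow> (nat \<Rightarrow> 'a) \<Rightarrow> (nat \<Rightarrow> nat) \<Rightarrow> 'a" where
  "jet m I H c y t = (\<Sum>x\<in>I. c x * (\<Prod>j<m. coeff (pcompose (H x j) [:y j, 1:]) (t j)))"

definition simplex :: "nat \<Rightarrow> nat \<Rightarrow> (nat \<Rightarrow> nat) set" where
  "simplex m s = {t \<in> {..<m} \<rightarrow>\<^sub>E {..<s}. (\<Sum>j<m. t j) < s}"

lemma finite_simplex: "finite (simplex m s)"
  unfolding simplex_def by (rule finite_subset[of _ "{..<m} \<rightarrow>\<^sub>E {..<s}"]) (auto intro: finite_PiE)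

lemma simplexI:
  assumes "t \<in> extensional {..<m}" "(\<Sum>j<m. t j) < s"
  shows "t \<in> simplex m s"
proof -
  have "t j < s" if "j < m" for j
    using assms(2) member_le_sum[of j "{..<m}" t] that by auto
  then show ?thesis
    using assms by (auto simp: simplex_def PiE_def)
qed

text \<open>Moving the base point along the line moves the parameter \<open>\<tau>\<close> to 0, so
  that multiplicity at \<open>\<tau>\<close> becomes divisibility by a power of
  \<open>T\<close>.\<close>

lemma line_restr_shift:
  "pcompose (line_restr m I H c p w) [:\<tau>, 1:] = line_restr m I H c (\<lambda>j. p j + \<tau> * w j) w"
proof -
  have "pcompose [:p j, w j:] [:\<tau>, 1:] = [:p j + \<tau> * w j, w j:]" for j
    by (simp add: pcompose_pCons mult.commute)
  then show ?thesis
    by (simp add: line_restr_def pcompose_sum pcompose_smult pcompose_prod pcompose_assoc[symmetric])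
qed

lemma jet_cong: "(\<And>j. j < m \<Longrightarrow> y j = y' j) \<Longrightarrow> jet m I H c y t = jet m I H c y' t"
  unfolding jet_def by (intro sum.cong refl arg_cong2[where f = times] prod.cong) auto

lemma jet_add: "jet m I H (c + d) y t = jet m I H c y t + jet m I H d y t"
  by (simp add: jet_def algebra_simps sum.distrib)

lemma line_restr_add: "line_restr m I H (c + d) p w = line_restr m I H c p w + line_restr m I H d p w"
  by (simp add: line_restr_def smult_add_left sum.distrib)

lemma pcompose_power: "pcompose (p ^ n) r = pcompose p r ^ n" for p :: "'a::comm_semiring_1 poly"
  by (induction n) (simp_all add: pcompose_mult pcompose_1)

lemma pcompose_monom_1: "pcompose (monom 1 n) r = r ^ n" for r :: "'a::comm_semiring_1 poly"
  by (simp add: monom_altdef pcompose_power pcompose_pCons)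

lemma smult_sum_right: "smult c (\<Sum>i\<in>S. f i) = (\<Sum>i\<in>S. smult c (f i))"
  by (induction S rule: infinite_finite_induct) (auto simp: smult_add_right)

lemma prod_monom:
  "(\<Prod>j\<in>A. monom (a j :: 'a::comm_semiring_1) (t j)) = monom (\<Prod>j\<in>A. a j) (\<Sum>j\<in>A. t j)"
  by (induction A rule: infinite_finite_induct) (auto simp: mult_monom)

text \<open>This is the Taylor expansion of \<open>f\<close> at \<open>y\<close>: each variable is
  expanded separately and the product over the variables is multiplied out. Any bound
  \<open>D\<close> on the degrees makes the index set finite.\<close>

lemma line_restr_expand:
  fixes H :: "'x \<Rightarrow> nat \<Rightarrow> 'a::field poly"
  assumes I: "finite I" and D: "\<And>x j. x \<in> I \<Longrightarrow> j < m \<Longrightarrow> degree (H x j) \<le> D"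
  shows "line_restr m I H c y w =
    (\<Sum>t\<in>{..<m} \<rightarrow>\<^sub>E {..D}. monom (jet m I H c y t * (\<Prod>j<m. w j ^ t j)) (\<Sum>j<m. t j))"
proof -
  let ?T = "{..<m} \<rightarrow>\<^sub>E {..D}"
  have one: "pcompose (H x j) [:y j, w j:] =
      (\<Sum>n\<le>D. monom (coeff (pcompose (H x j) [:y j, 1:]) n * w j ^ n) n)" if "x \<in> I" "j < m" for x j
  proof -
    have "pcompose (H x j) [:y j, w j:] = pcompose (pcompose (H x j) [:y j, 1:]) [:0, w j:]" (is "_ = ?r")
      by (simp add: pcompose_assoc[symmetric] pcompose_pCons)
    moreover have "degree ?r \<le> D"
      using D[OF that] by (intro order.trans[OF degree_pcompose_le]) (auto simp: degree_pCons_eq_if degree_pcompose)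
    then have "?r = (\<Sum>n\<le>D. monom (coeff ?r n) n)"
      by (rule poly_as_sum_of_monoms'[symmetric])
    ultimately show ?thesis
      by (simp add: coeff_pcompose_linear mult.commute)
  qed
  have "(\<Prod>j<m. pcompose (H x j) [:y j, w j:]) =
      (\<Sum>t\<in>?T. monom ((\<Prod>j<m. coeff (pcompose (H x j) [:y j, 1:]) (t j)) * (\<Prod>j<m. w j ^ t j)) (\<Sum>j<m. t j))"
    if x: "x \<in> I" for x
  proof -
    have "(\<Prod>j<m. pcompose (H x j) [:y j, w j:]) =
       (\<Prod>j<m. \<Sum>n\<le>D. monom (coeff (pcompose (H x j) [:y j, 1:]) n * w j ^ n) n)"
      by (intro prod.cong refl one x) auto
    also have "\<dots> = (\<Sum>t\<in>?T. \<Prod>j<m. monom (coeff (pcompose (H x j) [:y j, 1:]) (t j) * w j ^ t j) (t j))"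
      by (subst prod_sum_PiE) auto
    finally show ?thesis
      by (simp add: prod_monom prod.distrib)
  qed
  then have "line_restr m I H c y w = (\<Sum>x\<in>I. smult (c x) (\<Sum>t\<in>?T.
      monom ((\<Prod>j<m. coeff (pcompose (H x j) [:y j, 1:]) (t j)) * (\<Prod>j<m. w j ^ t j)) (\<Sum>j<m. t j)))"
    unfolding line_restr_def by (intro sum.cong refl) simp
  also have "\<dots> = (\<Sum>x\<in>I. \<Sum>t\<in>?T.
      monom (c x * (\<Prod>j<m. coeff (pcompose (H x j) [:y j, 1:]) (t j)) * (\<Prod>j<m. w j ^ t j)) (\<Sum>j<m. t j))"
    by (simp add: smult_sum_right smult_monom mult.assoc)
  also have "\<dots> = (\<Sum>t\<in>?T. \<Sum>x\<in>I.
      monom (c x * (\<Prod>j<m. coeff (pcompose (H x j) [:y j, 1:]) (t j)) * (\<Prod>j<m. w j ^ t j)) (\<Sum>j<m. t j))"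
    by (rule sum.swap)
  also have "\<dots> = (\<Sum>t\<in>?T. monom (jet m I H c y t * (\<Prod>j<m. w j ^ t j)) (\<Sum>j<m. t j))"
    by (simp add: jet_def sum_distrib_right monom_sum)
  finally show ?thesis .
qed

lemma line_restr_dvd:
  fixes H :: "'x \<Rightarrow> nat \<Rightarrow> 'a::field poly"
  assumes I: "finite I" and zero: "\<And>t. t \<in> simplex m s \<Longrightarrow> jet m I H c y t = 0"
  shows "monom 1 s dvd line_restr m I H c y w"
proof -
  define D where "D = (\<Sum>x\<in>I. \<Sum>j<m. degree (H x j))"
  have D: "degree (H x j) \<le> D" if "x \<in> I" "j < m" for x j
  proof -
    have "degree (H x j) \<le> (\<Sum>j<m. degree (H x j))"
      by (rule member_le_sum) (use that in auto)
    also have "\<dots> \<le> D"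
      unfolding D_def by (rule member_le_sum) (use that I in auto)
    finally show ?thesis .
  qed
  have expand: "line_restr m I H c y w =
      (\<Sum>t\<in>{..<m} \<rightarrow>\<^sub>E {..D}. monom (jet m I H c y t * (\<Prod>j<m. w j ^ t j)) (\<Sum>j<m. t j))"
    using line_restr_expand[OF I D] .
  show ?thesis
    unfolding expand
  proof (rule dvd_sum)
    fix t assume t: "t \<in> {..<m} \<rightarrow>\<^sub>E {..D}"
    show "monom 1 s dvd monom (jet m I H c y t * (\<Prod>j<m. w j ^ t j)) (\<Sum>j<m. t j)"
    proof (cases "(\<Sum>j<m. t j) < s")
      case True
      then have "t \<in> simplex m s"
        using t by (intro simplexI) (auto simp: PiE_def)
      then show ?thesis by (simp add: zero)
    next
      case False
      then have "monom (a :: 'a) (\<Sum>j<m. t j) = monom 1 s * monom a ((\<Sum>j<m. t j) - s)" for a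
        by (simp add: mult_monom)
      then show ?thesis by simp
    qed
  qed
qed

text \<open>Every \<open>\<tau>\<close> in \<open>A\<close> is a root of multiplicity at least
  \<open>s\<close>, so a nonzero restriction would have at least \<open>s * card A\<close> roots
  counted with multiplicity, more than its degree.\<close>

lemma line_restr_eq_0:
  fixes H :: "'x \<Rightarrow> nat \<Rightarrow> 'a::field poly"
  assumes I: "finite I" and A: "finite A" and s: "s > 0"
    and zero: "\<And>\<tau> t. \<tau> \<in> A \<Longrightarrow> t \<in> simplex m s \<Longrightarrow> jet m I H c (\<lambda>j. p j + \<tau> * w j) t = 0"
    and deg: "degree (line_restr m I H c p w) < s * card A"
  shows "line_restr m I H c p w = 0"
proof (rule ccontr)
  let ?F = "line_restr m I H c p w"
  assume F: "?F \<noteq> 0"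
  have ord: "s \<le> Polynomial.order \<tau> ?F" if \<tau>: "\<tau> \<in> A" for \<tau>
  proof -
    have "monom 1 s dvd pcompose ?F [:\<tau>, 1:]"
      unfolding line_restr_shift by (rule line_restr_dvd[OF I zero[OF \<tau>]])
    then obtain r where "pcompose ?F [:\<tau>, 1:] = monom 1 s * r" by (elim dvdE)
    then have "pcompose (pcompose ?F [:\<tau>, 1:]) [:-\<tau>, 1:] = pcompose (monom 1 1) [:-\<tau>, 1:] ^ s * pcompose r [:-\<tau>, 1:]"
      by (simp add: pcompose_mult pcompose_power[symmetric] monom_power)
    moreover have "pcompose (pcompose ?F [:\<tau>, 1:]) [:-\<tau>, 1:] = ?F"
      by (simp add: pcompose_assoc[symmetric] pcompose_pCons pcompose_idR)
    moreover have "pcompose (monom 1 1) [:-\<tau>, 1:] = [:-\<tau>, 1:]"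
      by (simp add: monom_altdef pcompose_pCons)
    ultimately have "[:-\<tau>, 1:] ^ s dvd ?F" by simp
    then show ?thesis using F by (simp add: order_divides)
  qed
  then have roots: "A \<subseteq> {x. poly ?F x = 0}"
    using s by (force simp: order_root)
  have "s * card A = (\<Sum>\<tau>\<in>A. s)" by simp
  also have "\<dots> \<le> (\<Sum>\<tau>\<in>A. Polynomial.order \<tau> ?F)"
    by (rule sum_mono) (rule ord)
  also have "\<dots> \<le> (\<Sum>\<tau> | poly ?F \<tau> = 0. Polynomial.order \<tau> ?F)"
    by (rule sum_mono2) (use roots poly_roots_finite[OF F] in auto)
  also have "\<dots> \<le> degree ?F"
    by (rule sum_order_le_degree[OF F])
  finally show False using deg by simp
qed

text \<open>\<open>G \<mu>\<close> is a polynomial in \<open>T\<close> whose coefficient at \<open>T^a\<close> has degree at most \<open>a\<close> in \<open>\<mu>\<close>. Hence \<open>a + 1\<close> lines of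
  a plane determine the derivatives of order \<open>a\<close> along all its lines.\<close>

definition graded :: "('a::field \<Rightarrow> 'a poly) \<Rightarrow> bool" where
  "graded G \<longleftrightarrow> (\<forall>a. \<exists>r. degree r \<le> a \<and> (\<forall>\<mu>. coeff (G \<mu>) a = poly r \<mu>))"

lemma graded_const: "graded (\<lambda>\<mu>. [:b:])"
  unfolding graded_def
proof
  fix a :: nat
  show "\<exists>r. degree r \<le> a \<and> (\<forall>\<mu>. coeff [:b:] a = poly r \<mu>)"
    by (rule exI[of _ "[:coeff [:b:] a:]"]) simp
qed

lemma graded_linear: "graded (\<lambda>\<mu>. [:b, v + \<mu> * u:])"
  unfolding graded_def
proof
  fix a :: nat
  show "\<exists>r. degree r \<le> a \<and> (\<forall>\<mu>. coeff [:b, v + \<mu> * u:] a = poly r \<mu>)"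
    by (rule exI[of _ "if a = 0 then [:b:] else if a = 1 then [:v, u:] else 0"])
       (auto simp: coeff_pCons split: nat.splits)
qed

lemma graded_add: "graded F \<Longrightarrow> graded G \<Longrightarrow> graded (\<lambda>\<mu>. F \<mu> + G \<mu>)"
  unfolding graded_def by (metis coeff_add degree_add_le poly_add)

lemma graded_mult:
  assumes "graded F" "graded G"
  shows "graded (\<lambda>\<mu>. F \<mu> * G \<mu>)"
proof -
  obtain f where f: "\<And>a. degree (f a) \<le> a" "\<And>a \<mu>. coeff (F \<mu>) a = poly (f a) \<mu>"
    using assms(1) unfolding graded_def by metis
  obtain g where g: "\<And>a. degree (g a) \<le> a" "\<And>a \<mu>. coeff (G \<mu>) a = poly (g a) \<mu>"
    using assms(2) unfolding graded_def by metis
  show ?thesis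
    unfolding graded_def
  proof
    fix a
    have "degree (f i * g (a - i)) \<le> a" if "i \<le> a" for i
      using degree_mult_le[of "f i" "g (a - i)"] f(1)[of i] g(1)[of "a - i"] that by linarith
    then have "degree (\<Sum>i\<le>a. f i * g (a - i)) \<le> a"
      by (intro degree_sum_le) auto
    then show "\<exists>r. degree r \<le> a \<and> (\<forall>\<mu>. coeff (F \<mu> * G \<mu>) a = poly r \<mu>)"
      by (intro exI[of _ "\<Sum>i\<le>a. f i * g (a - i)"]) (simp add: coeff_mult f g poly_sum)
  qed
qed

lemma graded_pcompose: "graded G \<Longrightarrow> graded (\<lambda>\<mu>. pcompose p (G \<mu>))"
proof (induction p)
  case 0
  then show ?case using graded_const[of 0] by simp
next
  case (pCons a p)
  then show ?case
    by (simp add: pcompose_pCons graded_add graded_mult graded_const)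
qed

lemma graded_prod: "finite A \<Longrightarrow> (\<And>j. j \<in> A \<Longrightarrow> graded (G j)) \<Longrightarrow> graded (\<lambda>\<mu>. \<Prod>j\<in>A. G j \<mu>)"
  by (induction A rule: finite_induct) (use graded_const[of 1] in \<open>auto simp: graded_mult one_pCons\<close>)

lemma graded_sum: "finite A \<Longrightarrow> (\<And>j. j \<in> A \<Longrightarrow> graded (G j)) \<Longrightarrow> graded (\<lambda>\<mu>. \<Sum>j\<in>A. G j \<mu>)"
  by (induction A rule: finite_induct) (use graded_const[of 0] in \<open>auto simp: graded_add\<close>)

lemma graded_line_restr:
  assumes "finite I"
  shows "graded (\<lambda>\<mu>. line_restr m I H c p (\<lambda>j. v j + \<mu> * u j))"
proof -
  have "graded (\<lambda>\<mu>. [:c x:] * (\<Prod>j<m. pcompose (H x j) [:p j, v j + \<mu> * u j:]))" for x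
    by (intro graded_mult graded_const graded_prod graded_pcompose graded_linear) auto
  then show ?thesis
    unfolding line_restr_def using assms by (intro graded_sum) simp_all
qed

section \<open>Polynomials with too many zeros\<close>

lemma poly_eq_0_of_roots:
  fixes p :: "'a::field poly"
  assumes "finite A" "\<And>x. x \<in> A \<Longrightarrow> poly p x = 0" "degree p < card A"
  shows "p = 0"
proof (rule ccontr)
  assume "p \<noteq> 0"
  have "card A \<le> card {x. poly p x = 0}"
    using assms by (intro card_mono poly_roots_finite[OF \<open>p \<noteq> 0\<close>]) auto
  also have "\<dots> \<le> degree p" by (rule card_poly_roots_bound[OF \<open>p \<noteq> 0\<close>])
  finally show False using assms(3) by simp
qed

text \<open>As a function of \<open>\<mu>\<close> the coefficient is a polynomial of degree at most
  \<open>a\<close>. More than \<open>a\<close> zeros make it vanish identically, in particular at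
  \<open>\<mu> = 0\<close>, which is the direction \<open>v\<close>.\<close>

lemma coeff_line_restr_eq_0:
  assumes "finite I" "finite M" "a < card M"
    and "\<And>\<mu>. \<mu> \<in> M \<Longrightarrow> line_restr m I H c p (\<lambda>j. v j + \<mu> * u j) = 0"
  shows "coeff (line_restr m I H c p v) a = 0"
proof -
  obtain r where r: "degree r \<le> a" "\<And>\<mu>. coeff (line_restr m I H c p (\<lambda>j. v j + \<mu> * u j)) a = poly r \<mu>"
    using graded_line_restr[OF assms(1), of m H c p v u] unfolding graded_def by metis
  have "r = 0"
    using r assms by (intro poly_eq_0_of_roots[of M]) (auto simp: r(2)[symmetric])
  then show ?thesis
    using r(2)[of 0] by simp
qed

text \<open>By induction on the variables: with the others fixed at grid points, the sum is a
  univariate polynomial in the new variable with too many roots, so its coefficients vanish on the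
  smaller grid.\<close>

lemma multivariate_vanishing:
  fixes S :: "'i \<Rightarrow> 'a::field set"
  assumes "finite A" "\<And>j. j \<in> A \<Longrightarrow> finite (S j) \<and> d j \<le> card (S j)"
    and "\<And>p. p \<in> Pi\<^sub>E A S \<Longrightarrow> (\<Sum>e\<in>(\<Pi>\<^sub>E j\<in>A. {..<d j}). a e * (\<Prod>j\<in>A. p j ^ e j)) = 0"
    and "e \<in> (\<Pi>\<^sub>E j\<in>A. {..<d j})"
  shows "a e = 0"
  using assms
proof (induction A arbitrary: a e rule: finite_induct)
  case empty
  then show ?case by (simp add: PiE_empty_domain)
next
  case (insert x A)
  let ?E = "\<Pi>\<^sub>E j\<in>A. {..<d j}"
  have fE: "finite ?E" by (intro finite_PiE insert) auto
  have zero: "(\<Sum>e'\<in>?E. a (e'(x := n)) * (\<Prod>j\<in>A. p j ^ e' j)) = 0" if p: "p \<in> Pi\<^sub>E A S" and n: "n < d x" for p n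
  proof -
    define b where "b n = (\<Sum>e'\<in>?E. a (e'(x := n)) * (\<Prod>j\<in>A. p j ^ e' j))" for n
    define P where "P = (\<Sum>n<d x. monom (b n) n)"
    have "poly P y = 0" if y: "y \<in> S x" for y
    proof -
      have "p(x := y) \<in> Pi\<^sub>E (insert x A) S"
        using p y by (auto simp: PiE_insert_eq)
      then have "0 = (\<Sum>e\<in>(\<Pi>\<^sub>E j\<in>insert x A. {..<d j}). a e * (\<Prod>j\<in>insert x A. (p(x := y)) j ^ e j))"
        by (rule insert.prems(2)[symmetric])
      also have "\<dots> = (\<Sum>z\<in>{..<d x} \<times> ?E. case z of (n, e') \<Rightarrow>
          a (e'(x := n)) * (\<Prod>j\<in>insert x A. (p(x := y)) j ^ (e'(x := n)) j))"
        unfolding PiE_insert_eq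
        by (subst sum.reindex) (use inj_combinator[OF \<open>x \<notin> A\<close>] in \<open>auto intro!: sum.cong\<close>)
      also have "\<dots> = (\<Sum>z\<in>{..<d x} \<times> ?E. case z of (n, e') \<Rightarrow>
          a (e'(x := n)) * (\<Prod>j\<in>A. p j ^ e' j) * y ^ n)"
      proof (intro sum.cong refl)
        fix z assume "z \<in> {..<d x} \<times> ?E"
        obtain n e' where z: "z = (n, e')" by (cases z)
        have "(\<Prod>j\<in>A. (p(x := y)) j ^ (e'(x := n)) j) = (\<Prod>j\<in>A. p j ^ e' j)"
          by (intro prod.cong) (use \<open>x \<notin> A\<close> in auto)
        then show "(case z of (n, e') \<Rightarrow> a (e'(x := n)) * (\<Prod>j\<in>insert x A. (p(x := y)) j ^ (e'(x := n)) j)) =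
            (case z of (n, e') \<Rightarrow> a (e'(x := n)) * (\<Prod>j\<in>A. p j ^ e' j) * y ^ n)"
          unfolding z using insert.hyps by simp
      qed
      also have "\<dots> = (\<Sum>n<d x. b n * y ^ n)"
        unfolding b_def sum_distrib_right by (rule sum.cartesian_product[symmetric])
      finally show ?thesis
        by (simp add: P_def poly_sum poly_monom)
    qed
    moreover have "degree P < card (S x)"
    proof -
      have "degree P \<le> d x - 1"
        unfolding P_def by (intro degree_sum_le) (auto intro!: order.trans[OF degree_monom_le])
      then show ?thesis using insert.prems(1)[of x] n by auto
    qed
    ultimately have "P = 0"
      using insert.prems(1)[of x] by (intro poly_eq_0_of_roots[of "S x"]) auto
    then have "coeff P n = 0" by simp
    then show ?thesis
      using n by (simp add: P_def coeff_sum coeff_monom b_def if_distrib sum.delta cong: if_cong)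
  qed
  have "e \<in> (\<lambda>(y, g). g(x := y)) ` ({..<d x} \<times> ?E)"
    using insert.prems(3) by (simp add: PiE_insert_eq)
  then obtain n e' where e: "e = e'(x := n)" "n < d x" "e' \<in> ?E" by auto
  show ?case
    unfolding e(1)
    by (rule insert.IH[of "\<lambda>e'. a (e'(x := n))", OF _ zero e(3)]) (use insert.prems(1) e in auto)
qed

section \<open>Multiplicity codes\<close>

context binary_field
begin

definition vanish_poly :: "'a poly" where
  "vanish_poly = monom 1 (2 ^ l) - monom 1 1"

text \<open>Polynomials are expanded in base \<open>X^q - X\<close> in each variable: the index \<open>(i, e)\<close> stands for
  \<open>\<Prod>j. (X\<^sub>j^q - X\<^sub>j)^(i j) * X\<^sub>j^(e j)\<close> with all \<open>e j < q\<close>. Bounding \<open>\<Sum>j. i j\<close> instead of the total degree makes the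
  dimension an exact multiple of \<open>q^m\<close>, and \<open>X^q - X\<close> is linear along lines of \<open>K^m\<close>.\<close>

definition adic_basis :: "(nat \<Rightarrow> nat) \<times> (nat \<Rightarrow> nat) \<Rightarrow> nat \<Rightarrow> 'a poly" where
  "adic_basis x j = vanish_poly ^ fst x j * monom 1 (snd x j)"

definition adic_index :: "nat \<Rightarrow> nat \<Rightarrow> ((nat \<Rightarrow> nat) \<times> (nat \<Rightarrow> nat)) set" where
  "adic_index m s = simplex m s \<times> ({..<m} \<rightarrow>\<^sub>E {..<2 ^ l})"

lemma q_gt_1: "1 < (2::nat) ^ l"
  using l_pos by (rule one_less_power[rotated]) simp

lemma finite_adic_index: "finite (adic_index m s)"
  by (auto simp: adic_index_def finite_simplex intro!: finite_PiE)

lemma card_adic_index: "card (adic_index m s) = card (simplex m s) * (2 ^ l) ^ m"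
  by (simp add: adic_index_def card_cartesian_product card_PiE)

text \<open>Raising to the power \<open>q = 2 ^ l\<close> is additive and fixes the elements of
  \<open>K\<close>, so the constant \<open>p\<close> cancels. Hence powers of \<open>X^q - X\<close>
  restrict to a line as powers of \<open>T^q - T\<close> up to a scalar.\<close>

lemma vanish_poly_pcompose:
  assumes "p \<in> K" "w \<in> K"
  shows "pcompose vanish_poly [:p, w:] = smult w vanish_poly"
proof -
  have "[:p, w:] ^ 2 ^ l = [:p:] + monom w (2 ^ l)"
  proof -
    have "[:p, w:] = [:p:] + monom w 1"
      by (simp add: monom_altdef)
    then have "[:p, w:] ^ 2 ^ l = [:p:] ^ 2 ^ l + monom w 1 ^ 2 ^ l"
      by (simp only: frobenius_add_poly)
    also have "\<dots> = [:p ^ 2 ^ l:] + monom (w ^ 2 ^ l) (2 ^ l)"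
      by (simp add: monom_power poly_const_pow)
    also have "\<dots> = [:p:] + monom w (2 ^ l)"
      using assms by (simp add: K_eq)
    finally show ?thesis .
  qed
  then have "pcompose vanish_poly [:p, w:] = [:p:] + monom w (2 ^ l) - [:p, w:]"
    unfolding vanish_poly_def pcompose_diff pcompose_monom_1 by simp
  also have "\<dots> = monom w (2 ^ l) - monom w 1"
    by (simp add: monom_altdef)
  finally show ?thesis
    by (simp add: vanish_poly_def smult_diff_right smult_monom)
qed

lemma degree_vanish_poly_le: "degree vanish_poly \<le> 2 ^ l"
  unfolding vanish_poly_def
  by (intro degree_diff_le order.trans[OF degree_monom_le]) auto

lemma degree_adic_basis_le: "degree (adic_basis x j) \<le> 2 ^ l * fst x j + snd x j"
proof -
  have "degree (adic_basis x j) \<le> degree (vanish_poly ^ fst x j) + degree (monom (1::'a) (snd x j))"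
    unfolding adic_basis_def by (rule degree_mult_le)
  also have "degree (vanish_poly ^ fst x j) \<le> degree vanish_poly * fst x j"
    by (rule degree_power_le)
  also have "\<dots> \<le> 2 ^ l * fst x j"
    by (intro mult_right_mono degree_vanish_poly_le) simp
  also have "degree (monom (1::'a) (snd x j)) \<le> snd x j"
    by (rule degree_monom_le)
  finally show ?thesis by simp
qed

text \<open>The degree is at most \<open>q * (s - 1) + m * (q - 1)\<close>, and
  \<open>q * (s - 1) < s * (q - 1)\<close> amounts to \<open>s < q\<close>. The bound is the number
  of conditions imposed by \<open>s + m\<close> orders at \<open>q - 1\<close> points of a
  line.\<close>

lemma degree_line_restr_less:
  assumes s: "0 < s" "s < 2 ^ l"
  shows "degree (line_restr m (adic_index m s) adic_basis c p w) < (s + m) * (2 ^ l - 1)"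
proof -
  let ?q = "2 ^ l :: nat"
  have "degree (\<Prod>j<m. pcompose (adic_basis x j) [:p j, w j:]) \<le> ?q * (s - 1) + m * (?q - 1)"
    if x: "x \<in> adic_index m s" for x
  proof -
    have "degree (\<Prod>j<m. pcompose (adic_basis x j) [:p j, w j:]) \<le>
        (\<Sum>j<m. degree (pcompose (adic_basis x j) [:p j, w j:]))"
      by (rule degree_prod_sum_le[unfolded o_def]) simp
    also have "\<dots> \<le> (\<Sum>j<m. ?q * fst x j + (?q - 1))"
    proof (rule sum_mono)
      fix j assume "j \<in> {..<m}"
      moreover have "snd x \<in> {..<m} \<rightarrow>\<^sub>E {..<?q}"
        using x by (simp add: adic_index_def mem_Times_iff)
      ultimately have "snd x j < ?q" using PiE_mem[of "snd x" "{..<m}" "\<lambda>_. {..<?q}" j] by simp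
      moreover have "degree (pcompose (adic_basis x j) [:p j, w j:]) \<le> degree (adic_basis x j)"
        using mult_le_mono2[of "degree [:p j, w j:]" 1 "degree (adic_basis x j)"]
        by (simp add: degree_pcompose degree_pCons_eq_if)
      ultimately show "degree (pcompose (adic_basis x j) [:p j, w j:]) \<le> ?q * fst x j + (?q - 1)"
        using degree_adic_basis_le[of x j] by linarith
    qed
    also have "\<dots> = ?q * (\<Sum>j<m. fst x j) + m * (?q - 1)"
      by (subst sum.distrib) (simp add: sum_distrib_left)
    also have "\<dots> \<le> ?q * (s - 1) + m * (?q - 1)"
    proof (intro add_right_mono mult_left_mono)
      have "(\<Sum>j<m. fst x j) < s"
        using x by (simp add: adic_index_def simplex_def mem_Times_iff)
      then show "(\<Sum>j<m. fst x j) \<le> s - 1" by linarith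
    qed simp
    finally show ?thesis .
  qed
  then have "degree (line_restr m (adic_index m s) adic_basis c p w) \<le> ?q * (s - 1) + m * (?q - 1)"
    unfolding line_restr_def using finite_adic_index
    by (intro degree_sum_le) (auto intro: order.trans[OF degree_smult_le])
  also have "\<dots> < (s + m) * (?q - 1)"
  proof -
    have "?q * (s - 1) < s * (?q - 1)"
      using s q_gt_1 by (simp add: diff_mult_distrib diff_mult_distrib2 mult.commute diff_less_mono2)
    then show ?thesis unfolding distrib_right by linarith
  qed
  finally show ?thesis .
qed

section \<open>Messages as coefficient vectors over \<open>K\<close>\<close>

lemma coeff_K_mult: "(\<And>i. coeff p i \<in> K) \<Longrightarrow> (\<And>i. coeff r i \<in> K) \<Longrightarrow> coeff (p * r) i \<in> K"
  by (rule coeff_mult_semiring_closed) (auto intro: K_add K_mult)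

lemma coeff_K_power: "(\<And>i. coeff p i \<in> K) \<Longrightarrow> coeff (p ^ n) i \<in> K"
  by (induction n arbitrary: i) (simp_all add: coeff_1 coeff_K_mult)

lemma coeff_K_prod: "(\<And>j i. j \<in> A \<Longrightarrow> coeff (f j) i \<in> K) \<Longrightarrow> coeff (\<Prod>j\<in>A. f j) i \<in> K"
  by (induction A arbitrary: i rule: infinite_finite_induct)
     (simp_all add: coeff_1 coeff_K_mult)

lemma coeff_K_adic_basis:
  assumes "p \<in> K" "w \<in> K"
  shows "coeff (pcompose (adic_basis x j) [:p, w:]) i \<in> K"
proof (rule coeff_pcompose_semiring_closed)
  show "coeff (adic_basis x j) i \<in> K" for i
    unfolding adic_basis_def vanish_poly_def
    by (rule coeff_K_mult[OF coeff_K_power]) (auto simp: coeff_monom intro: K_diff K_uminus)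
qed (use assms in \<open>auto intro: K_add K_mult simp: coeff_pCons split: nat.splits\<close>)

text \<open>The value outside the index set is 0 and not \<open>undefined\<close>, so that the set
  is closed under pointwise addition and contains the zero function.\<close>

definition coeff_space :: "nat \<Rightarrow> nat \<Rightarrow> ((nat \<Rightarrow> nat) \<times> (nat \<Rightarrow> nat) \<Rightarrow> 'a) set" where
  "coeff_space m s = {c. \<forall>x. (x \<in> adic_index m s \<longrightarrow> c x \<in> K) \<and> (x \<notin> adic_index m s \<longrightarrow> c x = 0)}"

lemma bij_coeff_space:
  "bij_betw (\<lambda>c. restrict c (adic_index m s)) (coeff_space m s) (adic_index m s \<rightarrow>\<^sub>E K)"
  by (rule bij_betwI[where g = "\<lambda>c x. if x \<in> adic_index m s then c x else 0"])
     (auto simp: coeff_space_def fun_eq_iff PiE_def extensional_def)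

lemma card_coeff_space: "card (coeff_space m s) = 2 ^ (card (simplex m s) * (2 ^ l) ^ m * l)"
  by (simp add: bij_betw_same_card[OF bij_coeff_space] card_PiE finite_adic_index card_K
      card_adic_index power_mult[symmetric] mult.commute)

lemma xor_group_coeff_space: "xor_group (coeff_space m s)"
proof -
  have "finite (coeff_space m s)"
    using bij_betw_finite[OF bij_coeff_space] by (simp add: finite_PiE finite_adic_index finite_K)
  moreover have "c + d \<in> coeff_space m s" if "c \<in> coeff_space m s" "d \<in> coeff_space m s" for c d
    using that unfolding coeff_space_def by (simp add: K_add)
  moreover have "c + c = 0" for c :: "(nat \<Rightarrow> nat) \<times> (nat \<Rightarrow> nat) \<Rightarrow> 'a"
    by (rule ext) (simp only: plus_fun_apply add_self zero_fun_apply)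
  ultimately show ?thesis
    by (simp add: xor_group_def coeff_space_def)
qed

lemma coeff_line_restr_K:
  assumes "c \<in> coeff_space m s" "\<And>j. j < m \<Longrightarrow> p j \<in> K" "\<And>j. j < m \<Longrightarrow> w j \<in> K"
  shows "coeff (line_restr m (adic_index m s) adic_basis c p w) a \<in> K"
  unfolding line_restr_def coeff_sum coeff_smult using assms
  by (intro K_sum K_mult coeff_K_prod coeff_K_adic_basis) (auto simp: coeff_space_def)

lemma jet_K:
  assumes "c \<in> coeff_space m s" "\<And>j. j < m \<Longrightarrow> y j \<in> K"
  shows "jet m (adic_index m s) adic_basis c y t \<in> K"
  unfolding jet_def using assms
  by (intro K_sum K_mult K_prod coeff_K_adic_basis) (auto simp: coeff_space_def)

text \<open>Since \<open>X^q - X = X * (X^(q-1) - 1)\<close>, its \<open>n\<close>-th power is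
  \<open>X^n\<close> times a polynomial with constant term \<open>(- 1) ^ n\<close>.\<close>

lemma coeff_vanish_poly_power_mult:
  assumes "t \<le> n"
  shows "coeff (vanish_poly ^ n * r) t = (if t = n then (- 1) ^ n * coeff r 0 else 0)"
proof -
  have "vanish_poly = monom 1 1 * (monom 1 (2 ^ l - 1) - 1)"
    using q_gt_1 by (simp add: vanish_poly_def algebra_simps mult_monom)
  then have eq: "vanish_poly ^ n * r = monom 1 n * ((monom 1 (2 ^ l - 1) - 1) ^ n * r)"
    by (simp add: power_mult_distrib monom_power mult.assoc)
  moreover have "coeff ((monom 1 (2 ^ l - 1) - 1) ^ n * r) 0 = (- 1) ^ n * coeff r 0"
    using q_gt_1 by (simp add: coeff_mult coeff_0_power coeff_monom)
  ultimately show ?thesis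
    unfolding eq using assms by (cases "t = n") (auto simp: coeff_monom_mult)
qed

text \<open>With \<open>d\<close> the sum of the entries of \<open>i\<close>, the index
  \<open>(i, e)\<close> contributes a multiple of \<open>(T^q - T)^d\<close>. At \<open>T^t\<close>
  those with \<open>d > t\<close> contribute nothing, and those with \<open>d < t\<close> are absent
  by hypothesis.\<close>

lemma coeff_line_restr_lowest:
  assumes p: "\<And>j. j < m \<Longrightarrow> p j \<in> K" and w: "\<And>j. j < m \<Longrightarrow> w j \<in> K"
    and low: "\<And>x. x \<in> adic_index m s \<Longrightarrow> (\<Sum>j<m. fst x j) < t \<Longrightarrow> c x = 0"
  shows "coeff (line_restr m (adic_index m s) adic_basis c p w) t =
    (- 1) ^ t * (\<Sum>x\<in>adic_index m s. if (\<Sum>j<m. fst x j) = t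
        then c x * (\<Prod>j<m. w j ^ fst x j) * (\<Prod>j<m. p j ^ snd x j) else 0)"
proof -
  have "c x * coeff (\<Prod>j<m. pcompose (adic_basis x j) [:p j, w j:]) t =
      (- 1) ^ t * (if (\<Sum>j<m. fst x j) = t
        then c x * (\<Prod>j<m. w j ^ fst x j) * (\<Prod>j<m. p j ^ snd x j) else 0)"
    if x: "x \<in> adic_index m s" for x
  proof -
    have "pcompose (adic_basis x j) [:p j, w j:] =
        smult (w j ^ fst x j) (vanish_poly ^ fst x j * [:p j, w j:] ^ snd x j)" if "j < m" for j
      using that by (simp add: adic_basis_def pcompose_mult pcompose_power pcompose_monom_1 vanish_poly_pcompose p w smult_power)
    then have "(\<Prod>j<m. pcompose (adic_basis x j) [:p j, w j:]) =
        smult (\<Prod>j<m. w j ^ fst x j) (vanish_poly ^ (\<Sum>j<m. fst x j) * (\<Prod>j<m. [:p j, w j:] ^ snd x j))"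
      by (simp add: prod_smult prod.distrib power_sum)
    moreover have "coeff (\<Prod>j<m. [:p j, w j:] ^ snd x j) 0 = (\<Prod>j<m. p j ^ snd x j)"
      by (simp add: poly_0_coeff_0[symmetric] poly_prod)
    ultimately show ?thesis
      using low[OF x] coeff_vanish_poly_power_mult[of t "\<Sum>j<m. fst x j" "\<Prod>j<m. [:p j, w j:] ^ snd x j"]
      by (cases "(\<Sum>j<m. fst x j) < t") simp_all
  qed
  then show ?thesis
    unfolding line_restr_def coeff_sum coeff_smult sum_distrib_left by (intro sum.cong refl) simp
qed

text \<open>If \<open>t\<close> is the lowest order in the \<open>X^q - X\<close> occurring in \<open>f\<close>, the coefficient of \<open>f (p + T w)\<close> at \<open>T^t\<close> is a
  polynomial function of \<open>(p, w)\<close> of degree below \<open>q\<close> in every coordinate.\<close>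

lemma coeff_space_separated:
  assumes m: "m > 0" and s: "s < 2 ^ l" and c: "c \<in> coeff_space m s"
    and zero: "\<And>p w a. p \<in> {..<m} \<rightarrow>\<^sub>E K \<Longrightarrow> w \<in> {..<m} \<rightarrow>\<^sub>E K \<Longrightarrow> w 0 = 1 \<Longrightarrow> a < s \<Longrightarrow>
      coeff (line_restr m (adic_index m s) adic_basis c p w) a = 0"
  shows "c = 0"
proof (rule ccontr)
  assume "c \<noteq> 0"
  then obtain x where "c x \<noteq> 0" by (auto simp: fun_eq_iff)
  then have ex: "x \<in> adic_index m s \<and> c x \<noteq> 0" using c unfolding coeff_space_def by blast
  obtain z where z: "z \<in> adic_index m s" "c z \<noteq> 0"
    and min: "\<And>x. x \<in> adic_index m s \<Longrightarrow> c x \<noteq> 0 \<Longrightarrow> (\<Sum>j<m. fst z j) \<le> (\<Sum>j<m. fst x j)"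
    using ex_has_least_nat[of "\<lambda>x. x \<in> adic_index m s \<and> c x \<noteq> 0" x "\<lambda>x. \<Sum>j<m. fst x j", OF ex]
    by (elim exE conjE) (rule that, assumption, assumption, blast)
  define t where "t = (\<Sum>j<m. fst z j)"
  have t: "t < s" using z(1) by (simp add: t_def adic_index_def simplex_def mem_Times_iff)
  let ?E = "{..<m} \<rightarrow>\<^sub>E {..<2 ^ l} :: (nat \<Rightarrow> nat) set"
  \<comment> \<open>Only indices of order exactly \<open>t\<close> are kept, which makes the sums
    below homogeneous of degree \<open>t\<close> in \<open>w\<close>. The coefficients are separated
    first through \<open>p\<close> and then through \<open>w\<close>.\<close>
  define a where "a e i = (if (\<Sum>j<m. i j) = t \<and> i \<in> simplex m s then c (i, e) else 0)" for e i
  have 1: "(\<Sum>i\<in>simplex m s. a e i * (\<Prod>j<m. w j ^ i j)) = 0"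
    if w: "w \<in> {..<m} \<rightarrow>\<^sub>E K" "w 0 = 1" and e: "e \<in> ?E" for w e
  proof (rule multivariate_vanishing[where A = "{..<m}" and S = "\<lambda>_. K" and d = "\<lambda>_. 2 ^ l", OF _ _ _ e])
    fix p assume p: "p \<in> {..<m} \<rightarrow>\<^sub>E K"
    have "0 = coeff (line_restr m (adic_index m s) adic_basis c p w) t"
      using zero[OF p w t] by simp
    also have "\<dots> = (- 1) ^ t * (\<Sum>x\<in>adic_index m s. if (\<Sum>j<m. fst x j) = t
        then c x * (\<Prod>j<m. w j ^ fst x j) * (\<Prod>j<m. p j ^ snd x j) else 0)"
    proof (rule coeff_line_restr_lowest)
      show "c x = 0" if "x \<in> adic_index m s" "(\<Sum>j<m. fst x j) < t" for x
        using min[OF that(1)] that(2) unfolding t_def by linarith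
    qed (use p w in auto)
    also have "(\<Sum>x\<in>adic_index m s. if (\<Sum>j<m. fst x j) = t
        then c x * (\<Prod>j<m. w j ^ fst x j) * (\<Prod>j<m. p j ^ snd x j) else 0) =
        (\<Sum>(i, e)\<in>simplex m s \<times> ?E. a e i * (\<Prod>j<m. w j ^ i j) * (\<Prod>j<m. p j ^ e j))"
      unfolding adic_index_def
    proof (intro sum.cong refl)
      fix x assume "x \<in> simplex m s \<times> ?E"
      then show "(if (\<Sum>j<m. fst x j) = t then c x * (\<Prod>j<m. w j ^ fst x j) * (\<Prod>j<m. p j ^ snd x j) else 0) =
          (case x of (i, e) \<Rightarrow> a e i * (\<Prod>j<m. w j ^ i j) * (\<Prod>j<m. p j ^ e j))"
        by (cases x) (simp add: a_def)
    qed
    also have "\<dots> = (\<Sum>i\<in>simplex m s. \<Sum>e\<in>?E. a e i * (\<Prod>j<m. w j ^ i j) * (\<Prod>j<m. p j ^ e j))"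
      by (rule sum.cartesian_product[symmetric])
    also have "\<dots> = (\<Sum>e\<in>?E. (\<Sum>i\<in>simplex m s. a e i * (\<Prod>j<m. w j ^ i j)) * (\<Prod>j<m. p j ^ e j))"
      by (subst sum.swap) (simp add: sum_distrib_right)
    finally show "(\<Sum>e\<in>?E. (\<Sum>i\<in>simplex m s. a e i * (\<Prod>j<m. w j ^ i j)) * (\<Prod>j<m. p j ^ e j)) = 0"
      by simp
  qed (auto simp: finite_K card_K)
  \<comment> \<open>The vanishing is known only for \<open>w 0 = 1\<close>; homogeneity extends it
    to \<open>w 0 \<noteq> 0\<close>. This leaves \<open>2 ^ l - 1 \<ge> s\<close> values for the
    first coordinate, enough because the exponents are below \<open>s\<close>.\<close>
  define S where "S j = (if j = 0 then K - {0} else K)" for j :: nat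
  have e: "snd z \<in> ?E" and i: "fst z \<in> {..<m} \<rightarrow>\<^sub>E {..<s}" "fst z \<in> simplex m s"
    using z(1) by (simp_all add: adic_index_def simplex_def mem_Times_iff)
  have "a (snd z) (fst z) = 0"
  proof (rule multivariate_vanishing[where A = "{..<m}" and S = S and d = "\<lambda>_. s", OF _ _ _ i(1)])
    fix w assume w: "w \<in> Pi\<^sub>E {..<m} S"
    have w0: "w 0 \<in> K" "w 0 \<noteq> 0" and wK: "\<And>j. j < m \<Longrightarrow> w j \<in> K"
      using w m by (auto simp: S_def PiE_def Pi_def split: if_splits)
    define v where "v = restrict (\<lambda>j. w j / w 0) {..<m}"
    have v: "v \<in> {..<m} \<rightarrow>\<^sub>E K" "v 0 = 1"
      using w0 wK m by (auto simp: v_def intro: K_divide)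
    have hom: "a (snd z) i * (\<Prod>j<m. w j ^ i j) = w 0 ^ t * (a (snd z) i * (\<Prod>j<m. v j ^ i j))" for i
    proof (cases "(\<Sum>j<m. i j) = t")
      case True
      have "(\<Prod>j<m. w j ^ i j) = (\<Prod>j<m. w 0 ^ i j * v j ^ i j)"
        by (intro prod.cong) (use w0 in \<open>auto simp: v_def power_mult_distrib[symmetric]\<close>)
      also have "\<dots> = w 0 ^ t * (\<Prod>j<m. v j ^ i j)"
        by (simp add: prod.distrib power_sum[symmetric] True)
      finally show ?thesis by (simp add: mult_ac)
    qed (simp add: a_def)
    have "(\<Sum>i\<in>simplex m s. a (snd z) i * (\<Prod>j<m. w j ^ i j)) = 0"
      using 1[OF v e] unfolding hom sum_distrib_left[symmetric] by simp
    also have "(\<Sum>i\<in>simplex m s. a (snd z) i * (\<Prod>j<m. w j ^ i j)) =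
        (\<Sum>i\<in>{..<m} \<rightarrow>\<^sub>E {..<s}. a (snd z) i * (\<Prod>j<m. w j ^ i j))"
      by (intro sum.mono_neutral_left) (auto simp: simplex_def a_def intro!: finite_PiE)
    finally show "(\<Sum>i\<in>{..<m} \<rightarrow>\<^sub>E {..<s}. a (snd z) i * (\<Prod>j<m. w j ^ i j)) = 0" .
  next
    show "finite (S j) \<and> s \<le> card (S j)" for j
      using s by (auto simp: S_def finite_K card_K)
  qed auto
  then show False
    using z i by (simp add: a_def t_def)
qed

end

section \<open>Lines and planes through a point\<close>

definition line_pt :: "nat \<Rightarrow> (nat \<Rightarrow> 'a::field) \<Rightarrow> 'a \<Rightarrow> (nat \<Rightarrow> 'a) \<Rightarrow> nat \<Rightarrow> 'a" where
  "line_pt m p \<tau> w = restrict (\<lambda>j. p j + \<tau> * w j) {..<m}"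

text \<open>Coordinate 0 determines \<open>\<tau>\<close>, as all directions have entry 1 there;
  coordinate 1 then determines \<open>\<mu>\<close>, and the others \<open>u\<close>. The inner
  \<open>line_pt\<close> forms the direction \<open>v + \<mu> * u\<close>.\<close>

lemma line_pt_plane_inj:
  assumes m: "m \<ge> 2" and v: "v 0 = 1"
    and u: "u \<in> extensional {..<m}" "u 0 = 0" "u 1 = 1" and u': "u' \<in> extensional {..<m}" "u' 0 = 0" "u' 1 = 1"
    and nz: "\<tau> \<noteq> 0" "\<mu> \<noteq> 0"
    and eq: "line_pt m p \<tau> (line_pt m v \<mu> u) = line_pt m p \<tau>' (line_pt m v \<mu>' u')"
  shows "\<mu> = \<mu>' \<and> u = u'"
proof -
  have eq': "\<tau> * (v j + \<mu> * u j) = \<tau>' * (v j + \<mu>' * u' j)" if "j < m" for j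
    using fun_cong[OF eq, of j] that by (simp add: line_pt_def)
  have t: "\<tau> = \<tau>'"
    using eq'[of 0] m u(2) u'(2) v by simp
  have \<mu>: "\<mu> = \<mu>'"
    using eq'[of 1] m u(3) u'(3) nz(1) unfolding t by simp
  have "u j = u' j" for j
  proof (cases "j < m")
    case True
    then show ?thesis using eq'[of j] nz unfolding t \<mu> by simp
  next
    case False
    then show ?thesis using u(1) u'(1) by (simp add: extensional_def)
  qed
  then show ?thesis using \<mu> by auto
qed

context binary_field
begin

lemma line_pt_in: "p \<in> {..<m} \<rightarrow>\<^sub>E K \<Longrightarrow> w \<in> {..<m} \<rightarrow>\<^sub>E K \<Longrightarrow> \<tau> \<in> K \<Longrightarrow> line_pt m p \<tau> w \<in> {..<m} \<rightarrow>\<^sub>E K"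
  unfolding line_pt_def by (auto intro!: K_add K_mult)

text \<open>Lines through \<open>p\<close> have directions \<open>v\<close> with \<open>v 0 = 1\<close>, so distinct directions are not parallel; the punctured
  lines of directions \<open>v + \<mu> * u\<close> with \<open>u \<in> plane_dirs m\<close> and \<open>\<mu> \<noteq> 0\<close> are pairwise disjoint.\<close>

definition plane_dirs :: "nat \<Rightarrow> (nat \<Rightarrow> 'a) set" where
  "plane_dirs m = (\<Pi>\<^sub>E j\<in>{..<m}. if j = 0 then {0} else if j = 1 then {1} else K)"

lemma card_plane_dirs:
  assumes "m \<ge> 2"
  shows "card (plane_dirs m) = (2 ^ l) ^ (m - 2)"
proof -
  obtain n where "m = Suc (Suc n)" using assms by (metis add_2_eq_Suc le_Suc_ex)
  then show ?thesis
    unfolding plane_dirs_def by (simp add: card_PiE prod.lessThan_Suc_shift card_K del: prod.lessThan_Suc)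
qed

lemma plane_dirsD:
  assumes "u \<in> plane_dirs m" "m \<ge> 2"
  shows "u \<in> {..<m} \<rightarrow>\<^sub>E K" "u 0 = 0" "u 1 = 1" "u \<in> extensional {..<m}"
proof -
  have mem: "u j \<in> (if j = 0 then {0} else if j = 1 then {1} else K)" if "j < m" for j
    using PiE_mem[OF assms(1)[unfolded plane_dirs_def], of j] that by simp
  show 0: "u 0 = 0" and 1: "u 1 = 1"
    using mem[of 0] mem[of 1] assms(2) by auto
  show ext: "u \<in> extensional {..<m}"
    using assms(1) by (simp add: plane_dirs_def PiE_def)
  have "u j \<in> K" if "j < m" for j
    using mem[OF that] K_0 K_1 by (auto split: if_splits)
  then show "u \<in> {..<m} \<rightarrow>\<^sub>E K"
    using ext by (simp add: PiE_def)
qed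

text \<open>Otherwise each of the \<open>(2 ^ l) ^ (m - 2)\<close> planes would have at least
  \<open>2 ^ l - s\<close> of its \<open>2 ^ l - 1\<close> directions blocked by points of
  \<open>Z\<close>. Blocked lines are disjoint off \<open>p\<close>, so choosing a point of
  \<open>Z\<close> on each contradicts the size of \<open>Z\<close>.\<close>

lemma ex_free_plane:
  assumes m: "m \<ge> 2" and v: "v 0 = 1" and s: "s \<le> 2 ^ l"
    and Z: "finite Z" "card Z < (2 ^ l) ^ (m - 2) * (2 ^ l - s)"
  shows "\<exists>u\<in>plane_dirs m. \<exists>M. M \<subseteq> K - {0} \<and> card M = s \<and>
    (\<forall>\<mu>\<in>M. \<forall>\<tau>\<in>K - {0}. line_pt m p \<tau> (line_pt m v \<mu> u) \<notin> Z)"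
proof -
  define hit where "hit u = {\<mu> \<in> K - {0}. \<exists>\<tau>\<in>K - {0}. line_pt m p \<tau> (line_pt m v \<mu> u) \<in> Z}" for u
  have fin: "finite (hit u)" for u
    using finite_K by (simp add: hit_def)
  have cK: "card (K - {0}) = 2 ^ l - 1"
    by (simp add: card_K finite_K)
  have "\<exists>u\<in>plane_dirs m. s \<le> card (K - {0} - hit u)"
  proof (rule ccontr)
    assume neg: "\<not> ?thesis"
    have ge: "2 ^ l - s \<le> card (hit u)" if "u \<in> plane_dirs m" for u
    proof -
      have "card (K - {0} - hit u) < s" using neg that by (metis not_le)
      moreover have "card (K - {0} - hit u) = card (K - {0}) - card (hit u)"
        by (rule card_Diff_subset[OF fin]) (auto simp: hit_def)
      ultimately show ?thesis using cK by linarith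
    qed
    have "(2 ^ l) ^ (m - 2) * (2 ^ l - s) = (\<Sum>u\<in>plane_dirs m. 2 ^ l - s)"
      by (simp add: card_plane_dirs[OF m])
    also have "\<dots> \<le> (\<Sum>u\<in>plane_dirs m. card (hit u))"
      by (rule sum_mono) (rule ge)
    also have "\<dots> = card (SIGMA u:plane_dirs m. hit u)"
    proof (rule card_SigmaI[symmetric])
      show "finite (plane_dirs m)"
        unfolding plane_dirs_def using finite_K by (intro finite_PiE) auto
    qed (use fin in auto)
    also have "\<dots> \<le> card Z"
    proof -
      define \<tau> where "\<tau> u \<mu> = (SOME \<tau>. \<tau> \<in> K - {0} \<and> line_pt m p \<tau> (line_pt m v \<mu> u) \<in> Z)" for u \<mu>
      have \<tau>: "\<tau> u \<mu> \<in> K - {0} \<and> line_pt m p (\<tau> u \<mu>) (line_pt m v \<mu> u) \<in> Z" if "\<mu> \<in> hit u" for u \<mu>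
      proof -
        have "\<exists>\<tau>. \<tau> \<in> K - {0} \<and> line_pt m p \<tau> (line_pt m v \<mu> u) \<in> Z"
          using that unfolding hit_def by blast
        then show ?thesis unfolding \<tau>_def by (rule someI_ex)
      qed
      let ?f = "\<lambda>(u, \<mu>). line_pt m p (\<tau> u \<mu>) (line_pt m v \<mu> u)"
      have "inj_on ?f (SIGMA u:plane_dirs m. hit u)"
      proof (rule inj_onI)
        fix x y assume x: "x \<in> (SIGMA u:plane_dirs m. hit u)" and y: "y \<in> (SIGMA u:plane_dirs m. hit u)"
          and eq: "?f x = ?f y"
        obtain u \<mu> u' \<mu>' where xy: "x = (u, \<mu>)" "y = (u', \<mu>')" by (cases x, cases y)
        have *: "u \<in> plane_dirs m" "u' \<in> plane_dirs m" "\<mu> \<in> hit u" "\<mu>' \<in> hit u'"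
          using x y xy by auto
        have nz: "\<tau> u \<mu> \<noteq> 0" "\<mu> \<noteq> 0"
          using \<tau>[OF *(3)] *(3) by (auto simp: hit_def)
        have eq: "line_pt m p (\<tau> u \<mu>) (line_pt m v \<mu> u) = line_pt m p (\<tau> u' \<mu>') (line_pt m v \<mu>' u')"
          using eq unfolding xy by simp
        note d = plane_dirsD[OF *(1) m] and d' = plane_dirsD[OF *(2) m]
        show "x = y"
          using line_pt_plane_inj[OF m v d(4,2,3) d'(4,2,3) nz eq] xy by simp
      qed
      moreover have "?f ` (SIGMA u:plane_dirs m. hit u) \<subseteq> Z"
        using \<tau> by (intro image_subsetI) auto
      ultimately show ?thesis
        using card_inj_on_le Z(1) by blast
    qed
    finally show False using Z(2) by simp
  qed
  then obtain u where u: "u \<in> plane_dirs m" "s \<le> card (K - {0} - hit u)" by blast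
  obtain M where M: "M \<subseteq> K - {0} - hit u" "card M = s"
    using obtain_subset_with_card_n[OF u(2)] by blast
  show ?thesis
  proof (intro bexI[OF _ u(1)] exI[of _ M] conjI M(2) ballI)
    show "M \<subseteq> K - {0}" using M(1) by blast
    fix \<mu> \<tau> assume \<mu>: "\<mu> \<in> M" and \<tau>: "\<tau> \<in> K - {0}"
    then have "\<mu> \<in> K - {0}" "\<mu> \<notin> hit u" using M(1) by auto
    then show "line_pt m p \<tau> (line_pt m v \<mu> u) \<notin> Z"
      using \<tau> unfolding hit_def by blast
  qed
qed

text \<open>Two interpolations are combined: derivatives of order below \<open>s + m\<close> at
  \<open>q - 1\<close> parameters kill the restriction to each of the \<open>s\<close> lines, and
  \<open>s > a\<close> lines of the plane kill the coefficient in direction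
  \<open>v\<close>.\<close>

lemma coeff_eq_0_of_plane:
  assumes s: "0 < s" "s < 2 ^ l" and M: "M \<subseteq> K - {0}" "card M = s" and a: "a < s"
    and zero: "\<And>\<mu> \<tau> t. \<mu> \<in> M \<Longrightarrow> \<tau> \<in> K - {0} \<Longrightarrow> t \<in> simplex m (s + m) \<Longrightarrow>
      jet m (adic_index m s) adic_basis c (line_pt m p \<tau> (line_pt m v \<mu> u)) t = 0"
  shows "coeff (line_restr m (adic_index m s) adic_basis c p v) a = 0"
proof (rule coeff_line_restr_eq_0[where M = M and u = u])
  show "finite (adic_index m s)" by (rule finite_adic_index)
  show "finite M" using M(1) finite_K by (meson finite_Diff finite_subset)
  show "a < card M" using M(2) a by simp
  fix \<mu> assume \<mu>: "\<mu> \<in> M"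
  show "line_restr m (adic_index m s) adic_basis c p (\<lambda>j. v j + \<mu> * u j) = 0"
  proof (rule line_restr_eq_0[where A = "K - {0}" and s = "s + m"])
    show "degree (line_restr m (adic_index m s) adic_basis c p (\<lambda>j. v j + \<mu> * u j)) < (s + m) * card (K - {0})"
      using degree_line_restr_less[OF s] by (simp add: card_K finite_K)
    fix \<tau> t assume "\<tau> \<in> K - {0}" "t \<in> simplex m (s + m)"
    note zero[OF \<mu> this]
    also have "jet m (adic_index m s) adic_basis c (line_pt m p \<tau> (line_pt m v \<mu> u)) t =
        jet m (adic_index m s) adic_basis c (\<lambda>j. p j + \<tau> * (v j + \<mu> * u j)) t"
      by (rule jet_cong) (simp add: line_pt_def)
    finally show "jet m (adic_index m s) adic_basis c (\<lambda>j. p j + \<tau> * (v j + \<mu> * u j)) t = 0" .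
  qed (use finite_adic_index finite_K s in auto)
qed

text \<open>The hypothesis on \<open>k\<close> keeps \<open>k\<close> recovering sets of
  \<open>s * (2 ^ l - 1)\<close> points each within the bound of \<open>ex_free_plane\<close>.
  Disjointness is arranged for points of the space; a point then supplies all its codeword
  positions.\<close>

theorem multiplicity_batch_code:
  assumes m: "m \<ge> 2" and s: "0 < s" "s < 2 ^ l"
    and k: "k * (s * (2 ^ l - 1)) \<le> (2 ^ l) ^ (m - 2) * (2 ^ l - s)"
  shows "has_batch_code ((2 ^ l) ^ m * (card (simplex m (s + m)) * l)) (card (simplex m s) * (2 ^ l) ^ m * l) k"
proof -
  obtain B where B: "finite B" "card B = l" and B_hom: "\<forall>\<phi>\<in>B. xor_hom K \<phi>"
    and B0: "\<forall>x\<in>K. (\<forall>\<phi>\<in>B. \<not> \<phi> x) \<longrightarrow> x = 0"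
    by (rule ex_bit_functionals) (rule that)
  let ?I = "adic_index m s" and ?V = "coeff_space m s" and ?Pt = "{..<m} \<rightarrow>\<^sub>E K"
  let ?jet = "jet m ?I adic_basis" and ?lr = "line_restr m ?I adic_basis"
  let ?S = "simplex m (s + m)"
  define D where "D = s * (2 ^ l - 1 :: nat)"
  have D: "D > 0" using s q_gt_1 by (simp add: D_def)
  define W where "W = {w \<in> ?Pt. w 0 = 1}"
  define \<Lambda> where "\<Lambda> = (\<lambda>(b, a, p, v) c. b (coeff (?lr c p v) a) :: bool) ` (B \<times> {..<s} \<times> ?Pt \<times> W)"
  define T where "T = ?Pt \<times> ?S \<times> B"
  define \<Phi> where "\<Phi> = (\<lambda>(y, t, b) c. b (?jet c y t) :: bool)"
  define P where "P \<phi> R \<longleftrightarrow> (\<forall>c\<in>?V. (\<forall>y\<in>R. \<forall>t\<in>?S. ?jet c y t = 0) \<longrightarrow> \<not> \<phi> c)" for \<phi> :: "_ \<Rightarrow> bool" and R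
  have \<Lambda>E: "\<exists>b a p v. \<phi> = (\<lambda>c. b (coeff (?lr c p v) a)) \<and> b \<in> B \<and> a < s \<and> p \<in> ?Pt \<and> v \<in> W" if "\<phi> \<in> \<Lambda>" for \<phi>
  proof -
    obtain z where z: "z \<in> B \<times> {..<s} \<times> ?Pt \<times> W" "\<phi> = (\<lambda>(b, a, p, v) c. b (coeff (?lr c p v) a)) z"
      using \<open>\<phi> \<in> \<Lambda>\<close> unfolding \<Lambda>_def by (rule imageE)
    obtain b a p v where bapv: "z = (b, a, p, v)" by (cases z)
    show ?thesis
      by (rule exI[of _ b], rule exI[of _ a], rule exI[of _ p], rule exI[of _ v]) (use z in \<open>simp add: bapv\<close>)
  qed
  have step: "\<exists>R. P \<phi> R \<and> R \<subseteq> ?Pt \<and> R \<inter> Z = {} \<and> finite R \<and> card R \<le> D"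
    if \<phi>: "\<phi> \<in> \<Lambda>" and Z: "finite Z" "card Z < k * D" for \<phi> Z
  proof -
    obtain b a p v where \<phi>_eq: "\<phi> = (\<lambda>c. b (coeff (?lr c p v) a))"
      and b: "b \<in> B" and a: "a < s" and p: "p \<in> ?Pt" and v: "v \<in> W"
      using \<Lambda>E[OF \<phi>] by (elim exE conjE) (rule that)
    have v': "v \<in> ?Pt" "v 0 = 1" using v by (simp_all add: W_def)
    have Z': "card Z < (2 ^ l) ^ (m - 2) * (2 ^ l - s)"
      using Z(2) k by (simp add: D_def)
    obtain u M where u: "u \<in> plane_dirs m" and M: "M \<subseteq> K - {0}" "card M = s"
      and free: "\<forall>\<mu>\<in>M. \<forall>\<tau>\<in>K - {0}. line_pt m p \<tau> (line_pt m v \<mu> u) \<notin> Z"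
      using ex_free_plane[of m v s Z p, OF m v'(2) less_imp_le[OF s(2)] Z(1) Z']
      by (elim bexE exE conjE) (rule that)
    define R where "R = (\<lambda>(\<mu>, \<tau>). line_pt m p \<tau> (line_pt m v \<mu> u)) ` (M \<times> (K - {0}))"
    have finM: "finite M" using M(1) finite_K by (meson finite_Diff finite_subset)
    have R1: "R \<subseteq> ?Pt"
    proof
      fix y assume "y \<in> R"
      then obtain \<mu> \<tau> where "\<mu> \<in> M" "\<tau> \<in> K - {0}" "y = line_pt m p \<tau> (line_pt m v \<mu> u)"
        unfolding R_def by auto
      moreover from this have "\<mu> \<in> K" "\<tau> \<in> K" using M(1) by auto
      ultimately show "y \<in> ?Pt"
        using line_pt_in[OF p line_pt_in[OF v'(1) plane_dirsD(1)[OF u m]]] by simp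
    qed
    have R2: "R \<inter> Z = {}"
      unfolding R_def using free by auto
    have R3: "finite R"
      unfolding R_def using finM finite_K by simp
    have "card R \<le> card (M \<times> (K - {0}))"
      unfolding R_def by (rule card_image_le) (use finM finite_K in simp)
    then have R4: "card R \<le> D"
      by (simp add: card_cartesian_product M(2) card_K finite_K D_def)
    have "P \<phi> R"
      unfolding P_def
    proof (intro ballI impI)
      fix c assume "c \<in> ?V" and z: "\<forall>y\<in>R. \<forall>t\<in>?S. ?jet c y t = 0"
      have "coeff (?lr c p v) a = 0"
      proof (rule coeff_eq_0_of_plane[OF s M a])
        fix \<mu> \<tau> t assume "\<mu> \<in> M" "\<tau> \<in> K - {0}" "t \<in> ?S"
        then have "line_pt m p \<tau> (line_pt m v \<mu> u) \<in> R" unfolding R_def by force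
        then show "?jet c (line_pt m p \<tau> (line_pt m v \<mu> u)) t = 0"
          using z \<open>t \<in> ?S\<close> by blast
      qed
      then show "\<not> \<phi> c"
        unfolding \<phi>_eq using xor_hom_0[OF xor_group_K bspec[OF B_hom b]] by simp
    qed
    then show ?thesis using R1 R2 R3 R4 by blast
  qed
  have "has_batch_code (card T) (card (simplex m s) * (2 ^ l) ^ m * l) k"
  proof (rule batch_code_from_functionals[where V = ?V and \<Lambda> = \<Lambda> and \<Phi> = \<Phi>])
    show "xor_group ?V" by (rule xor_group_coeff_space)
    show "card ?V = 2 ^ (card (simplex m s) * (2 ^ l) ^ m * l)" by (rule card_coeff_space)
    show "xor_hom ?V \<phi>" if \<phi>: "\<phi> \<in> \<Lambda>" for \<phi>
    proof -
      obtain b a p v where \<phi>_eq: "\<phi> = (\<lambda>c. b (coeff (?lr c p v) a))"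
        and b: "b \<in> B" and a: "a < s" and p: "p \<in> ?Pt" and v: "v \<in> W"
        using \<Lambda>E[OF \<phi>] by (elim exE conjE) (rule that)
      have "coeff (?lr c p v) a \<in> K" if "c \<in> ?V" for c
        by (rule coeff_line_restr_K[OF that]) (use p v in \<open>auto simp: W_def\<close>)
      then show ?thesis
        using bspec[OF B_hom b] unfolding \<phi>_eq xor_hom_def by (simp add: line_restr_add)
    qed
    show "\<exists>\<phi>\<in>\<Lambda>. \<phi> c" if c: "c \<in> ?V" "c \<noteq> 0" for c
    proof (rule ccontr)
      assume neg: "\<not> (\<exists>\<phi>\<in>\<Lambda>. \<phi> c)"
      have "c = 0"
      proof (rule coeff_space_separated[OF _ s(2) c(1)])
        fix p w a assume pw: "p \<in> ?Pt" "w \<in> ?Pt" "w 0 = 1" and a: "a < s"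
        have nb: "\<not> b (coeff (?lr c p w) a)" if "b \<in> B" for b
        proof -
          have "(\<lambda>c. b (coeff (?lr c p w) a)) \<in> \<Lambda>"
            unfolding \<Lambda>_def by (rule image_eqI[of _ _ "(b, a, p, w)"]) (use that pw a in \<open>simp_all add: W_def\<close>)
          then show ?thesis using neg by (rule_tac notI) (erule notE, erule bexI[rotated])
        qed
        have inK: "coeff (?lr c p w) a \<in> K"
          by (rule coeff_line_restr_K[OF c(1)]) (use pw in auto)
        show "coeff (?lr c p w) a = 0" by (rule bspec[OF B0 inK, THEN mp]) (rule ballI, rule nb)
      qed (use m in simp)
      then show False using c(2) by simp
    qed
    show "finite T"
      unfolding T_def using B(1) finite_K finite_simplex by (auto intro!: finite_PiE)
    show "xor_hom ?V (\<Phi> x)" if "x \<in> T" for x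
    proof -
      obtain y t b where x: "x = (y, t, b)" by (cases x)
      have yb: "y \<in> ?Pt" "b \<in> B" using that unfolding x T_def by auto
      have "?jet c y t \<in> K" if "c \<in> ?V" for c
        by (rule jet_K[OF that]) (use yb in auto)
      then show ?thesis
        using bspec[OF B_hom yb(2)] unfolding x \<Phi>_def xor_hom_def by (simp add: jet_add)
    qed
    fix qs assume qs: "length qs = k" "set qs \<subseteq> \<Lambda>"
    have "\<exists>R. (\<forall>j<length qs. P (qs ! j) (R j) \<and> R j \<subseteq> ?Pt \<and> finite (R j) \<and> card (R j) \<le> D) \<and>
        (\<forall>j<length qs. \<forall>j'<length qs. j \<noteq> j' \<longrightarrow> R j \<inter> R j' = {})"
      by (rule greedy_disjoint_choice[where k = k, OF step]) (use qs D in simp_all)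
    then obtain R where R: "\<forall>j<k. P (qs ! j) (R j) \<and> R j \<subseteq> ?Pt \<and> finite (R j) \<and> card (R j) \<le> D"
        "\<forall>j<k. \<forall>j'<k. j \<noteq> j' \<longrightarrow> R j \<inter> R j' = {}"
      unfolding qs(1) by (elim exE conjE) (rule that)
    have "\<not> (qs ! j) c" if j: "j < k" and c: "c \<in> ?V" and z: "\<forall>t\<in>R j \<times> ?S \<times> B. \<not> \<Phi> t c" for j c
    proof -
      have "P (qs ! j) (R j)" and sub: "R j \<subseteq> ?Pt" using R(1) j by simp_all
      moreover have "?jet c y t = 0" if y: "y \<in> R j" and t: "t \<in> ?S" for y t
      proof -
        have inK: "?jet c y t \<in> K"
          by (rule jet_K[OF c]) (use sub y in auto)
        have nb: "\<not> b (?jet c y t)" if "b \<in> B" for b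
          using bspec[OF z, of "(y, t, b)"] y t that by (simp add: \<Phi>_def)
        show ?thesis by (rule bspec[OF B0 inK, THEN mp]) (rule ballI, rule nb)
      qed
      ultimately show ?thesis using c unfolding P_def by simp
    qed
    then show "\<exists>R. (\<forall>j<k. R j \<subseteq> T) \<and> (\<forall>j<k. \<forall>j'<k. j \<noteq> j' \<longrightarrow> R j \<inter> R j' = {}) \<and>
        (\<forall>j<k. \<forall>x\<in>?V. (\<forall>t\<in>R j. \<not> \<Phi> t x) \<longrightarrow> \<not> (qs ! j) x)"
      using R by (intro exI[of _ "\<lambda>j. R j \<times> ?S \<times> B"]) (simp add: T_def Times_Int_Times Sigma_mono)
  qed
  moreover have "card T = (2 ^ l) ^ m * (card ?S * l)"
    by (simp add: T_def card_cartesian_product card_PiE card_K B(2))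
  ultimately show ?thesis by simp
qed

end

section \<open>Parities over lines with directions on a conic\<close>

text \<open>Each earlier query rules out at most one direction, so fewer than \<open>card D\<close>
  are ruled out.\<close>

lemma greedy_direction_choice:
  assumes D: "finite D" and few: "\<And>p p' x'. x' \<in> D \<Longrightarrow> card {x \<in> D. R p x \<inter> R p' x' \<noteq> {}} \<le> 1"
    and len: "length ps \<le> card D"
  shows "\<exists>f. (\<forall>j<length ps. f j \<in> D) \<and>
    (\<forall>j<length ps. \<forall>j'<length ps. j \<noteq> j' \<longrightarrow> R (ps ! j) (f j) \<inter> R (ps ! j') (f j') = {})"
  using len
proof (induction ps rule: rev_induct)
  case Nil
  then show ?case by simp
next
  case (snoc p ps)
  then have "length ps \<le> card D" by simp
  from snoc.IH[OF this] obtain f where f: "\<forall>j<length ps. f j \<in> D"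
    "\<forall>j<length ps. \<forall>j'<length ps. j \<noteq> j' \<longrightarrow> R (ps ! j) (f j) \<inter> R (ps ! j') (f j') = {}"
    by (elim exE conjE) (rule that)
  define bad where "bad = (\<Union>j<length ps. {x \<in> D. R p x \<inter> R (ps ! j) (f j) \<noteq> {}})"
  have "card bad \<le> (\<Sum>j<length ps. card {x \<in> D. R p x \<inter> R (ps ! j) (f j) \<noteq> {}})"
    unfolding bad_def by (rule card_UN_le) simp
  also have "\<dots> \<le> (\<Sum>j<length ps. 1)"
    by (rule sum_mono, rule few) (use f(1) in simp)
  also have "\<dots> < card D" using snoc.prems by simp
  finally have "card bad < card D" .
  moreover have "finite bad" unfolding bad_def using D by simp
  ultimately have "\<not> D \<subseteq> bad" using card_mono[of bad D] by linarith
  then obtain x where x: "x \<in> D" "x \<notin> bad" by blast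
  have dj: "R p x \<inter> R (ps ! j) (f j) = {}" if "j < length ps" for j
    using x that unfolding bad_def by blast
  let ?f = "f(length ps := x)"
  have "?f j \<in> D" if "j < length (ps @ [p])" for j
    using f(1) x(1) that by (auto simp: less_Suc_eq)
  moreover have "R ((ps @ [p]) ! j) (?f j) \<inter> R ((ps @ [p]) ! j') (?f j') = {}"
    if "j < length (ps @ [p])" "j' < length (ps @ [p])" "j \<noteq> j'" for j j'
  proof -
    have "j < length ps \<or> j = length ps" "j' < length ps \<or> j' = length ps"
      using that by auto
    then consider "j < length ps" "j' < length ps" | "j = length ps" "j' < length ps" | "j < length ps" "j' = length ps"
      using \<open>j \<noteq> j'\<close> by blast
    then show ?thesis
      using f(2) \<open>j \<noteq> j'\<close> dj by cases (auto simp: nth_append)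
  qed
  ultimately show ?case by blast
qed

text \<open>The line through \<open>p\<close> in direction \<open>(1, x, x\<^sup>2)\<close> is encoded by \<open>x\<close> and its point with first coordinate \<open>0\<close>.\<close>

definition conic_line :: "'a::field \<Rightarrow> 'a \<times> 'a \<times> 'a \<Rightarrow> 'a \<times> 'a \<times> 'a" where
  "conic_line x p = (x, fst (snd p) - fst p * x, snd (snd p) - fst p * x\<^sup>2)"

text \<open>This is the recovering set of the bit at \<open>p\<close>: the parity of its line and
  the other points of \<open>Q\<close> on that line. \<open>Inl\<close> marks information positions
  and \<open>Inr\<close> parity positions.\<close>

definition conic_block :: "('a::field \<times> 'a \<times> 'a) set \<Rightarrow> 'a \<times> 'a \<times> 'a \<Rightarrow> 'a \<Rightarrow> ('a \<times> 'a \<times> 'a + 'a \<times> 'a \<times> 'a) set" where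
  "conic_block Q p x = insert (Inr (conic_line x p)) (Inl ` {y \<in> Q. conic_line x y = conic_line x p \<and> y \<noteq> p})"

text \<open>Whether the blocks share an information position or a parity position, the two affine
  lines share a point other than \<open>p\<close>, which is what \<open>\<tau> \<noteq> 0\<close>
  records.\<close>

lemma conic_block_meet:
  assumes "conic_block Q p x \<inter> conic_block Q p' z \<noteq> {}"
  obtains \<tau> \<sigma> where "\<tau> \<noteq> 0" "fst p + \<tau> = fst p' + \<sigma>"
    "fst (snd p) + \<tau> * x = fst (snd p') + \<sigma> * z" "snd (snd p) + \<tau> * x\<^sup>2 = snd (snd p') + \<sigma> * z\<^sup>2"
proof -
  obtain p1 p2 p3 where p: "p = (p1, p2, p3)" by (cases p)
  obtain q1 q2 q3 where p': "p' = (q1, q2, q3)" by (cases p')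
  obtain b where b: "b \<in> conic_block Q p x" "b \<in> conic_block Q p' z" using assms by blast
  show ?thesis
  proof (cases b)
    case (Inr c)
    then have "conic_line x p = conic_line z p'"
      using b by (auto simp: conic_block_def)
    then have eq: "x = z" "p2 - p1 * z = q2 - q1 * z" "p3 - p1 * z\<^sup>2 = q3 - q1 * z\<^sup>2"
      by (auto simp: conic_line_def p p')
    \<comment> \<open>A shared parity means that the two lines coincide, so any nonzero parameter,
      here 1, gives a common point.\<close>
    show ?thesis
      by (rule that[of 1 "p1 + 1 - q1"]) (use eq in \<open>simp_all add: p p' algebra_simps\<close>)
  next
    case (Inl y)
    obtain y1 y2 y3 where y: "y = (y1, y2, y3)" by (cases y)
    have *: "conic_line x y = conic_line x p" "y \<noteq> p" "conic_line z y = conic_line z p'"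
      using b Inl by (auto simp: conic_block_def)
    then have eq: "y2 - y1 * x = p2 - p1 * x" "y3 - y1 * x\<^sup>2 = p3 - p1 * x\<^sup>2"
      "y2 - y1 * z = q2 - q1 * z" "y3 - y1 * z\<^sup>2 = q3 - q1 * z\<^sup>2"
      by (simp_all add: conic_line_def p p' y)
    have "y1 \<noteq> p1" using eq(1,2) *(2) by (auto simp: y p)
    show ?thesis
    proof (rule that[of "y1 - p1" "y1 - q1"])
      show "fst (snd p) + (y1 - p1) * x = fst (snd p') + (y1 - q1) * z"
      proof -
        have "y2 = p2 + (y1 - p1) * x" using eq(1) by (simp add: algebra_simps)
        moreover have "y2 = q2 + (y1 - q1) * z" using eq(3) by (simp add: algebra_simps)
        ultimately show ?thesis by (simp add: p p')
      qed
      show "snd (snd p) + (y1 - p1) * x\<^sup>2 = snd (snd p') + (y1 - q1) * z\<^sup>2"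
      proof -
        have "y3 = p3 + (y1 - p1) * x\<^sup>2" using eq(2) by (simp add: algebra_simps)
        moreover have "y3 = q3 + (y1 - q1) * z\<^sup>2" using eq(4) by (simp add: algebra_simps)
        ultimately show ?thesis by (simp add: p p')
      qed
    qed (use \<open>y1 \<noteq> p1\<close> in \<open>simp_all add: p p'\<close>)
  qed
qed

text \<open>Three distinct points of a conic are not collinear.\<close>

lemma conic_block_meet_unique:
  fixes p :: "'a::field \<times> 'a \<times> 'a"
  assumes "conic_block Q p x \<inter> conic_block Q p' z \<noteq> {}" "conic_block Q p x' \<inter> conic_block Q p' z \<noteq> {}"
  shows "x = x'"
proof -
  obtain t s where t: "t \<noteq> 0" "fst p + t = fst p' + s"
    "fst (snd p) + t * x = fst (snd p') + s * z" "snd (snd p) + t * x\<^sup>2 = snd (snd p') + s * z\<^sup>2"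
    using conic_block_meet[OF assms(1)] .
  obtain t' s' where t': "t' \<noteq> 0" "fst p + t' = fst p' + s'"
    "fst (snd p) + t' * x' = fst (snd p') + s' * z" "snd (snd p) + t' * x'\<^sup>2 = snd (snd p') + s' * z\<^sup>2"
    using conic_block_meet[OF assms(2)] .
  have cancel: "b - b' = c - c'" if "A + b = B + c" "A + b' = B + c'" for A B b b' c c' :: 'a
    using that by (metis add_diff_cancel_left)
  have s: "t - t' = s - s'"
    by (rule cancel[OF t(2) t'(2)])
  have "t * x - t' * x' = (t - t') * z"
    using cancel[OF t(3) t'(3)] unfolding s by (simp add: left_diff_distrib)
  then have 1: "t * (x - z) = t' * (x' - z)"
    by (simp add: algebra_simps)
  have "t * x\<^sup>2 - t' * x'\<^sup>2 = (t - t') * z\<^sup>2"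
    using cancel[OF t(4) t'(4)] unfolding s by (simp add: left_diff_distrib)
  then have "t * (x - z) * (x + z) = t' * (x' - z) * (x' + z)"
    by (simp add: algebra_simps power2_eq_square)
  \<comment> \<open>Either \<open>x = x'\<close>, or \<open>x = z\<close>, and then the first
    relation with \<open>t' \<noteq> 0\<close> gives \<open>x' = z\<close>.\<close>
  then have "t * (x - z) * (x - x') = 0"
    unfolding 1[symmetric] by (simp add: algebra_simps)
  then show ?thesis
    using 1 t(1) t'(1) by auto
qed

section \<open>The group of messages with one bit per point\<close>

lemma bit_add_neq_0: "(a + b \<noteq> (0::bit)) \<longleftrightarrow> (a \<noteq> 0) \<noteq> (b \<noteq> 0)"
  by (cases a; cases b) simp_all

definition bit_space :: "'p set \<Rightarrow> ('p \<Rightarrow> bit) set" where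
  "bit_space Q = {f. \<forall>p. p \<notin> Q \<longrightarrow> f p = 0}"

lemma card_bit_space:
  assumes "finite Q"
  shows "card (bit_space Q) = 2 ^ card Q" "finite (bit_space Q)"
proof -
  have bij: "bij_betw (\<lambda>f. {p. f p \<noteq> 0}) (bit_space Q) (Pow Q)"
    by (rule bij_betwI[where g = "\<lambda>A p. of_bool (p \<in> A)"]) (auto simp: bit_space_def)
  show "card (bit_space Q) = 2 ^ card Q"
    using bij_betw_same_card[OF bij] by (simp add: card_Pow assms)
  show "finite (bit_space Q)"
    using bij_betw_finite[OF bij] assms by simp
qed

lemma xor_group_bit_space: "finite Q \<Longrightarrow> xor_group (bit_space Q)"
  unfolding xor_group_def using card_bit_space(2)[of Q] by (auto simp: bit_space_def fun_eq_iff)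

context binary_field
begin

text \<open>The \<open>n\<close> bits are stored themselves, at points of \<open>K^3\<close>. One
  parity is added for each of the \<open>d\<close> directions and each of the
  \<open>(2 ^ l)\<^sup>2\<close> parallel lines, and the queries choose their directions
  greedily.\<close>

theorem conic_batch_code:
  assumes n: "n \<le> (2 ^ l) ^ 3" and d: "d \<le> 2 ^ l"
  shows "has_batch_code (n + d * (2 ^ l)\<^sup>2) n d"
proof -
  have "n \<le> card (K \<times> K \<times> K)"
    using n by (simp add: card_cartesian_product card_K power3_eq_cube)
  then obtain Q where Q: "Q \<subseteq> K \<times> K \<times> K" "card Q = n" "finite Q"
    using obtain_subset_with_card_n by metis
  obtain D where D: "D \<subseteq> K" "card D = d" "finite D"
    using obtain_subset_with_card_n[of d K] d card_K by metis
  define \<Lambda> where "\<Lambda> = (\<lambda>p f. f p \<noteq> (0::bit)) ` Q"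
  define T where "T = Q <+> (D \<times> K \<times> K)"
  define \<Phi> where "\<Phi> t f = (case t of Inl p \<Rightarrow> f p \<noteq> (0::bit)
    | Inr c \<Rightarrow> (\<Sum>y\<in>{y \<in> Q. conic_line (fst c) y = c}. f y) \<noteq> 0)" for t and f :: "_ \<Rightarrow> bit"
  have "has_batch_code (card T) n d"
  proof (rule batch_code_from_functionals[where V = "bit_space Q" and \<Lambda> = \<Lambda> and \<Phi> = \<Phi>])
    show "xor_group (bit_space Q)" by (rule xor_group_bit_space[OF Q(3)])
    show "card (bit_space Q) = 2 ^ n" using card_bit_space(1)[OF Q(3)] Q(2) by simp
    show "xor_hom (bit_space Q) \<phi>" if \<phi>: "\<phi> \<in> \<Lambda>" for \<phi>
    proof -
      obtain p where p: "\<phi> = (\<lambda>f. f p \<noteq> 0)" using \<phi> unfolding \<Lambda>_def by blast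
      show ?thesis unfolding p xor_hom_def plus_fun_apply bit_add_neq_0 by blast
    qed
    show "\<exists>\<phi>\<in>\<Lambda>. \<phi> f" if f: "f \<in> bit_space Q" "f \<noteq> 0" for f
    proof -
      have "\<not> (\<forall>p. f p = 0)" using f(2) by (metis ext zero_fun_apply)
      then obtain p where "f p \<noteq> 0" by blast
      moreover from this have "p \<in> Q" using f(1) unfolding bit_space_def by blast
      ultimately show ?thesis unfolding \<Lambda>_def by (simp add: rev_bexI)
    qed
    show "finite T" unfolding T_def using Q(3) D(3) finite_K by simp
    show "xor_hom (bit_space Q) (\<Phi> t)" if "t \<in> T" for t
    proof (cases t)
      case (Inl p)
      then show ?thesis unfolding xor_hom_def \<Phi>_def Inl sum.case plus_fun_apply bit_add_neq_0 by blast
    next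
      case (Inr c)
      then show ?thesis unfolding xor_hom_def \<Phi>_def Inr sum.case plus_fun_apply sum.distrib bit_add_neq_0 by blast
    qed
    fix qs assume qs: "length qs = d" "set qs \<subseteq> \<Lambda>"
    have "\<forall>j<d. \<exists>p\<in>Q. qs ! j = (\<lambda>f. f p \<noteq> 0)"
    proof (intro allI impI)
      fix j assume "j < d"
      then have "qs ! j \<in> \<Lambda>" using qs by (metis nth_mem subsetD)
      then show "\<exists>p\<in>Q. qs ! j = (\<lambda>f. f p \<noteq> 0)" unfolding \<Lambda>_def by (elim imageE) (rule bexI)
    qed
    then obtain pt where pt: "\<And>j. j < d \<Longrightarrow> pt j \<in> Q" "\<And>j. j < d \<Longrightarrow> qs ! j = (\<lambda>f. f (pt j) \<noteq> 0)"
      by metis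
    have few: "card {x \<in> D. conic_block Q p x \<inter> conic_block Q p' x' \<noteq> {}} \<le> 1" for p p' x'
      using D(3) conic_block_meet_unique[of Q p _ p' x']
      by (subst card_le_Suc0_iff_eq[unfolded One_nat_def[symmetric]]) auto
    have "length (map pt [0..<d]) \<le> card D" using D(2) by simp
    from greedy_direction_choice[where R = "conic_block Q", OF D(3) few this]
    have "\<exists>f. (\<forall>j<d. f j \<in> D) \<and> (\<forall>j<d. \<forall>j'<d. j \<noteq> j' \<longrightarrow>
        conic_block Q (pt j) (f j) \<inter> conic_block Q (pt j') (f j') = {})"
      by simp
    then obtain f where "\<forall>j<d. f j \<in> D"
      "\<forall>j<d. \<forall>j'<d. j \<noteq> j' \<longrightarrow> conic_block Q (pt j) (f j) \<inter> conic_block Q (pt j') (f j') = {}"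
      by (elim exE conjE) (rule that)
    note f = this[rule_format]
    have "conic_block Q (pt j) (f j) \<subseteq> T" if j: "j < d" for j
    proof -
      have "conic_line (f j) (pt j) \<in> D \<times> K \<times> K"
        using f(1)[OF j] pt(1)[OF j] Q(1) D(1) unfolding conic_line_def
        by (auto intro!: K_diff K_mult K_power)
      then show ?thesis unfolding conic_block_def T_def by auto
    qed
    moreover have "\<not> (qs ! j) g" if j: "j < d" and z: "\<forall>t\<in>conic_block Q (pt j) (f j). \<not> \<Phi> t g" for j g
    proof -
      let ?L = "{y \<in> Q. conic_line (f j) y = conic_line (f j) (pt j)}"
      have "\<Phi> (Inr (conic_line (f j) (pt j))) g \<longleftrightarrow> (\<Sum>y\<in>?L. g y) \<noteq> 0"
        by (simp add: \<Phi>_def conic_line_def)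
      then have "(\<Sum>y\<in>?L. g y) = 0"
        using z by (simp add: conic_block_def)
      moreover have "(\<Sum>y\<in>?L. g y) = g (pt j) + (\<Sum>y\<in>?L - {pt j}. g y)"
        by (rule sum.remove) (use pt(1)[OF j] Q(3) in auto)
      moreover have "(\<Sum>y\<in>?L - {pt j}. g y) = 0"
      proof (rule sum.neutral, rule ballI)
        fix y assume "y \<in> ?L - {pt j}"
        then have "Inl y \<in> conic_block Q (pt j) (f j)" by (auto simp: conic_block_def)
        then have "\<not> \<Phi> (Inl y) g" using z by blast
        then show "g y = 0" by (simp add: \<Phi>_def)
      qed
      ultimately show ?thesis by (simp add: pt(2)[OF j])
    qed
    ultimately show "\<exists>R. (\<forall>j<d. R j \<subseteq> T) \<and> (\<forall>j<d. \<forall>j'<d. j \<noteq> j' \<longrightarrow> R j \<inter> R j' = {}) \<and>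
        (\<forall>j<d. \<forall>x\<in>bit_space Q. (\<forall>t\<in>R j. \<not> \<Phi> t x) \<longrightarrow> \<not> (qs ! j) x)"
      using f(2) by (intro exI[of _ "\<lambda>j. conic_block Q (pt j) (f j)"]) simp
  qed
  moreover have "card T = n + d * (2 ^ l)\<^sup>2"
    unfolding T_def using Q D finite_K
    by (simp add: card_Plus card_cartesian_product card_K power2_eq_square)
  ultimately show ?thesis by simp
qed

end

section \<open>Modifying batch codes\<close>

text \<open>The surplus information bits are fixed to zero.\<close>

lemma batch_code_shorten:
  assumes "has_batch_code N n k" "n' \<le> n"
  shows "has_batch_code N n' k"
proof -
  obtain S where S: "batch_code N n k S" using assms(1) by (auto simp: has_batch_code_def)
  define S' where "S' t = S t \<inter> {..<n'}" for t
  have enc: "enc S' x t = enc S (\<lambda>i. i < n' \<and> x i) t" for x t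
    unfolding enc_def S'_def by (rule arg_cong[where f = "\<lambda>A. odd (card A)"]) auto
  have rec: "recovers S' R i" if "recovers S R i" "i < n'" for R i
    unfolding recovers_iff
  proof (intro allI impI)
    fix x y assume "\<forall>t\<in>R. enc S' x t = enc S' y t"
    then have "(i < n' \<and> x i) = (i < n' \<and> y i)"
      using that(1) unfolding recovers_iff enc by blast
    then show "x i = y i" using that(2) by simp
  qed
  have "batch_code N n' k S'"
    unfolding batch_code_def
  proof (intro conjI allI impI)
    show "lin_code n' N S'" by (auto simp: lin_code_def S'_def)
    fix "is" :: "nat list" assume "is": "length is = k \<and> set is \<subseteq> {..<n'}"
    then have "length is = k \<and> set is \<subseteq> {..<n}" using assms(2) by auto
    then obtain R where R: "\<forall>j<k. R j \<subseteq> {..<N}" "\<forall>j<k. \<forall>j'<k. j \<noteq> j' \<longrightarrow> R j \<inter> R j' = {}"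
      "\<forall>j<k. recovers S (R j) (is ! j)"
      using S unfolding batch_code_def by blast
    have "recovers S' (R j) (is ! j)" if "j < k" for j
      using R(3) that "is" by (intro rec) (auto dest: nth_mem)
    then show "\<exists>R. (\<forall>j<k. R j \<subseteq> {..<N}) \<and> (\<forall>j<k. \<forall>j'<k. j \<noteq> j' \<longrightarrow> R j \<inter> R j' = {}) \<and>
        (\<forall>j<k. recovers S' (R j) (is ! j))"
      using R by blast
  qed
  then show ?thesis by (auto simp: has_batch_code_def)
qed

text \<open>The query list is padded with copies of its first entry, and the recovering sets of the
  padding are discarded.\<close>

lemma batch_code_fewer_queries:
  assumes "has_batch_code N n k" "k' \<le> k"
  shows "has_batch_code N n k'"
proof -
  obtain S where S: "batch_code N n k S" using assms(1) by (auto simp: has_batch_code_def)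
  have "batch_code N n k' S"
    unfolding batch_code_def
  proof (intro conjI allI impI)
    show "lin_code n N S" using S by (simp add: batch_code_def)
    fix "is" :: "nat list" assume "is": "length is = k' \<and> set is \<subseteq> {..<n}"
    show "\<exists>R. (\<forall>j<k'. R j \<subseteq> {..<N}) \<and> (\<forall>j<k'. \<forall>j'<k'. j \<noteq> j' \<longrightarrow> R j \<inter> R j' = {}) \<and>
        (\<forall>j<k'. recovers S (R j) (is ! j))"
    proof (cases "k' = 0")
      case False
      let ?is = "is @ replicate (k - k') (hd is)"
      have "is \<noteq> []" using False "is" by auto
      then have "hd is \<in> set is" by simp
      then have "length ?is = k \<and> set ?is \<subseteq> {..<n}" using "is" assms(2) by auto
      then obtain R where R: "\<forall>j<k. R j \<subseteq> {..<N}" "\<forall>j<k. \<forall>j'<k. j \<noteq> j' \<longrightarrow> R j \<inter> R j' = {}"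
        "\<forall>j<k. recovers S (R j) (?is ! j)"
        using S unfolding batch_code_def by blast
      have "recovers S (R j) (is ! j)" if "j < k'" for j
        using R(3)[rule_format, of j] that assms(2) "is" by (simp add: nth_append)
      then show ?thesis using R assms(2) by (intro exI[of _ R]) auto
    qed simp
  qed
  then show ?thesis by (auto simp: has_batch_code_def)
qed

text \<open>Copies of the code are placed side by side, and copy \<open>a\<close> answers the
  \<open>k\<close> queries starting at position \<open>a * k\<close>.\<close>

lemma batch_code_repeat:
  assumes "has_batch_code N n k"
  shows "has_batch_code (r * N) n (r * k)"
proof -
  obtain S where S: "batch_code N n k S" using assms(1) by (auto simp: has_batch_code_def)
  define S' where "S' t = S (t mod N)" for t
  have "batch_code (r * N) n (r * k) S'"
    unfolding batch_code_def
  proof (intro conjI allI impI)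
    show "lin_code n (r * N) S'"
      unfolding lin_code_def
    proof (intro allI impI)
      fix t assume "t < r * N"
      then have "t mod N < N" by (cases "N = 0") simp_all
      then show "S' t \<subseteq> {..<n}" using S by (simp add: batch_code_def lin_code_def S'_def)
    qed
    fix "is" :: "nat list" assume "is": "length is = r * k \<and> set is \<subseteq> {..<n}"
    have "\<exists>R. (\<forall>j<k. R j \<subseteq> {..<N}) \<and> (\<forall>j<k. \<forall>j'<k. j \<noteq> j' \<longrightarrow> R j \<inter> R j' = {}) \<and>
        (\<forall>j<k. recovers S (R j) (is ! (a * k + j)))" if a: "a < r" for a
    proof -
      have "(a + 1) * k \<le> length is" using a "is" by (intro order.trans[OF mult_le_mono1[of "a + 1" r k]]) auto
      then have len: "length (take k (drop (a * k) is)) = k" by simp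
      have sub: "set (take k (drop (a * k) is)) \<subseteq> {..<n}"
        using "is" by (auto dest!: in_set_takeD in_set_dropD)
      obtain R where "\<forall>j<k. R j \<subseteq> {..<N}" "\<forall>j<k. \<forall>j'<k. j \<noteq> j' \<longrightarrow> R j \<inter> R j' = {}"
        "\<forall>j<k. recovers S (R j) (take k (drop (a * k) is) ! j)"
        using S len sub unfolding batch_code_def by blast
      then show ?thesis
        using \<open>(a + 1) * k \<le> length is\<close> by (intro exI[of _ R]) auto
    qed
    then obtain R where R: "\<And>a. a < r \<Longrightarrow> (\<forall>j<k. R a j \<subseteq> {..<N}) \<and>
        (\<forall>j<k. \<forall>j'<k. j \<noteq> j' \<longrightarrow> R a j \<inter> R a j' = {}) \<and> (\<forall>j<k. recovers S (R a j) (is ! (a * k + j)))"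
      by metis
    define R' where "R' j = (\<lambda>t. (j div k) * N + t) ` R (j div k) (j mod k)" for j
    have idx: "j div k < r" "j mod k < k" if "j < r * k" for j
      using that by (simp_all add: less_mult_imp_div_less) (cases "k = 0"; simp)
    have RN: "t < N" if "j < r * k" "t \<in> R (j div k) (j mod k)" for j t
      using R[OF idx(1)[OF that(1)]] idx(2)[OF that(1)] that(2) by blast
    have "R' j \<subseteq> {..<r * N}" if j: "j < r * k" for j
    proof
      fix t assume "t \<in> R' j"
      then obtain u where u: "u \<in> R (j div k) (j mod k)" "t = (j div k) * N + u" by (auto simp: R'_def)
      then have "t < (j div k + 1) * N" using RN[OF j u(1)] by simp
      also have "\<dots> \<le> r * N" using idx(1)[OF j] by (intro mult_le_mono1) simp
      finally show "t \<in> {..<r * N}" by simp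
    qed
    moreover have "R' j \<inter> R' j' = {}" if j: "j < r * k" and j': "j' < r * k" and ne: "j \<noteq> j'" for j j'
    proof (rule ccontr)
      assume "R' j \<inter> R' j' \<noteq> {}"
      then obtain u u' where u: "u \<in> R (j div k) (j mod k)" "u' \<in> R (j' div k) (j' mod k)"
        "(j div k) * N + u = (j' div k) * N + u'" by (auto simp: R'_def)
      have lt: "u < N" "u' < N" using RN j j' u by auto
      have "((j div k) * N + u) div N = j div k" "((j' div k) * N + u') div N = j' div k"
        "((j div k) * N + u) mod N = u" "((j' div k) * N + u') mod N = u'"
        using lt by simp_all
      then have d: "j div k = j' div k" and uu: "u = u'" using u(3) by metis+
      then have "j mod k \<noteq> j' mod k" using ne by (metis div_mult_mod_eq)
      then have "R (j div k) (j mod k) \<inter> R (j div k) (j' mod k) = {}"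
        using R[OF idx(1)[OF j]] idx(2)[OF j] idx(2)[OF j'] by blast
      then show False using u(1,2) uu d by auto
    qed
    moreover have "recovers S' (R' j) (is ! j)" if j: "j < r * k" for j
    proof -
      have rec: "recovers S (R (j div k) (j mod k)) (is ! j)"
        using conjunct2[OF conjunct2[OF R[OF idx(1)[OF j]]], rule_format, OF idx(2)[OF j]]
        by (simp only: div_mult_mod_eq)
      have enc: "enc S' x ((j div k) * N + t) = enc S x t" if "t \<in> R (j div k) (j mod k)" for x t
        using RN[OF j that] by (simp add: enc_def S'_def)
      show ?thesis
        unfolding recovers_iff
      proof (intro allI impI)
        fix x y assume "\<forall>t\<in>R' j. enc S' x t = enc S' y t"
        then have "\<forall>t\<in>R (j div k) (j mod k). enc S x t = enc S y t"
          using enc by (auto simp: R'_def)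
        then show "x (is ! j) = y (is ! j)"
          using rec unfolding recovers_iff by blast
      qed
    qed
    ultimately show "\<exists>R. (\<forall>j<r * k. R j \<subseteq> {..<r * N}) \<and> (\<forall>j<r * k. \<forall>j'<r * k. j \<noteq> j' \<longrightarrow> R j \<inter> R j' = {}) \<and>
        (\<forall>j<r * k. recovers S' (R j) (is ! j))"
      by (intro exI[of _ R']) simp
  qed
  then show ?thesis by (auto simp: has_batch_code_def)
qed

section \<open>Choice of parameters\<close>

text \<open>The new multi-indices have sum exactly \<open>s\<close>, so the first \<open>m\<close>
  entries, each at most \<open>s\<close>, determine the last.\<close>

lemma card_simplex_Suc_le: "card (simplex (Suc m) (Suc s)) \<le> card (simplex (Suc m) s) + (Suc s) ^ m"
proof -
  let ?A = "{t \<in> simplex (Suc m) (Suc s). (\<Sum>j<Suc m. t j) = s}"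
  have split: "simplex (Suc m) (Suc s) \<subseteq> simplex (Suc m) s \<union> ?A"
  proof
    fix t assume t: "t \<in> simplex (Suc m) (Suc s)"
    then have "t \<in> extensional {..<Suc m}" "(\<Sum>j<Suc m. t j) < Suc s"
      by (auto simp: simplex_def PiE_def)
    then show "t \<in> simplex (Suc m) s \<union> ?A"
      using simplexI[of t "Suc m" s] t by (cases "(\<Sum>j<Suc m. t j) = s") auto
  qed
  have fin: "finite ?A" using finite_simplex by simp
  have "card ?A \<le> card ({..<m} \<rightarrow>\<^sub>E {..<Suc s})"
  proof (rule card_inj_on_le[where f = "\<lambda>t. restrict t {..<m}"])
    show "(\<lambda>t. restrict t {..<m}) ` ?A \<subseteq> {..<m} \<rightarrow>\<^sub>E {..<Suc s}"
      by (auto simp: simplex_def PiE_def Pi_def)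
    show "inj_on (\<lambda>t. restrict t {..<m}) ?A"
    proof (rule inj_onI)
      fix t u assume t: "t \<in> ?A" and u: "u \<in> ?A" and eq: "restrict t {..<m} = restrict u {..<m}"
      have low: "t j = u j" if "j < m" for j
        using fun_cong[OF eq, of j] that by simp
      have "(\<Sum>j<m. t j) = (\<Sum>j<m. u j)" by (intro sum.cong) (auto simp: low)
      then have "t m = u m" using t u by simp
      then have "t j = u j" if "j < Suc m" for j
        using low that by (auto simp: less_Suc_eq)
      moreover have "t \<in> extensional {..<Suc m}" "u \<in> extensional {..<Suc m}"
        using t u by (auto simp: simplex_def PiE_def)
      ultimately show "t = u" by (intro extensionalityI) auto
    qed
  qed (auto intro: finite_PiE)
  also have "\<dots> = (Suc s) ^ m" by (simp add: card_PiE)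
  finally have "card ?A \<le> (Suc s) ^ m" .
  moreover have "card (simplex (Suc m) (Suc s)) \<le> card (simplex (Suc m) s \<union> ?A)"
    by (rule card_mono[OF _ split]) (use fin finite_simplex in simp)
  ultimately show ?thesis
    using card_Un_le[of "simplex (Suc m) s" ?A] by linarith
qed

lemma card_simplex_add_le: "card (simplex (Suc m) (s + d)) \<le> card (simplex (Suc m) s) + d * (s + d) ^ m"
proof (induction d)
  case (Suc d)
  have "card (simplex (Suc m) (s + Suc d)) \<le> card (simplex (Suc m) (s + d)) + (s + Suc d) ^ m"
    using card_simplex_Suc_le[of m "s + d"] by simp
  also have "\<dots> \<le> card (simplex (Suc m) s) + d * (s + d) ^ m + (s + Suc d) ^ m"
    using Suc by simp
  also have "d * (s + d) ^ m \<le> d * (s + Suc d) ^ m"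
    by (intro mult_left_mono power_mono) auto
  finally show ?case by (simp add: algebra_simps)
qed simp

text \<open>A cube of side \<open>b\<close> fits into the simplex: its largest coordinate sum
  \<open>4 * (b - 1)\<close> is below \<open>s\<close>.\<close>

lemma card_simplex_ge: "b ^ 4 \<le> card (simplex 4 s)" if "4 * b \<le> s + 3"
proof (cases "b = 0")
  case False
  have "{..<4} \<rightarrow>\<^sub>E {..<b} \<subseteq> simplex 4 s"
  proof
    fix t :: "nat \<Rightarrow> nat" assume t: "t \<in> {..<4} \<rightarrow>\<^sub>E {..<b}"
    have "(\<Sum>j<4. t j) \<le> (\<Sum>j<(4::nat). b - 1)"
    proof (rule sum_mono)
      fix j :: nat assume "j \<in> {..<4}"
      then have "t j < b" using t by auto
      then show "t j \<le> b - 1" by simp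
    qed
    then have "(\<Sum>j<4. t j) < s" using that False by simp
    then show "t \<in> simplex 4 s" using t by (intro simplexI) (auto simp: PiE_def)
  qed
  then have "card ({..<4::nat} \<rightarrow>\<^sub>E {..<b}) \<le> card (simplex 4 s)"
    by (rule card_mono[OF finite_simplex])
  then show ?thesis by (simp add: card_PiE)
qed simp

lemma card_simplex_ge_real: "(real s / 4) ^ 4 \<le> real (card (simplex 4 s))"
proof -
  define b where "b = (s + 3) div 4"
  have "4 * b \<le> s + 3" "s \<le> 4 * b" by (auto simp: b_def)
  then have "(real s / 4) ^ 4 \<le> real b ^ 4"
    by (intro power_mono) auto
  also have "\<dots> \<le> real (card (simplex 4 s))"
    using card_simplex_ge[OF \<open>4 * b \<le> s + 3\<close>] by (metis of_nat_le_iff of_nat_power)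
  finally show ?thesis .
qed

section \<open>Codes over concrete fields, and rounding to powers of two\<close>

lemma conic_batch_code:
  assumes "l > 0" "n \<le> (2 ^ l) ^ 3" "d \<le> 2 ^ l"
  shows "has_batch_code (n + d * (2 ^ l)\<^sup>2) n d"
  using binary_field.conic_batch_code[OF ex_binary_field] assms by blast

text \<open>For \<open>s\<close> at most half of \<open>q = 2 ^ l\<close>, the factor
  \<open>q - s\<close> is at least half of \<open>q - 1\<close>, so the counting condition on
  \<open>k\<close> follows from \<open>2 * k * s \<le> q^2\<close>.\<close>

lemma multiplicity_batch_code:
  assumes l: "l > 0" and s: "0 < s" "2 * s \<le> 2 ^ l" and k: "2 * k * s \<le> (2 ^ l)\<^sup>2"
  shows "has_batch_code ((2 ^ l) ^ 4 * (card (simplex 4 (s + 4)) * l)) (card (simplex 4 s) * (2 ^ l) ^ 4 * l) k"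
proof (rule binary_field.multiplicity_batch_code[OF ex_binary_field[OF l]])
  show "s < 2 ^ l" using s by linarith
  have "2 * (k * (s * (2 ^ l - 1))) = 2 * k * s * (2 ^ l - 1)" by simp
  also have "\<dots> \<le> (2 ^ l)\<^sup>2 * (2 * (2 ^ l - s))"
    by (rule mult_le_mono[OF k]) (use s in linarith)
  finally show "k * (s * (2 ^ l - 1)) \<le> (2 ^ l) ^ (4 - 2) * (2 ^ l - s)" by simp
qed (use s in simp_all)

lemma ex_power_of_two:
  fixes x :: real
  assumes "x > 1"
  obtains l :: nat where "l > 0" "x \<le> 2 ^ l" "2 ^ l \<le> 2 * x" "log 2 x \<le> real l" "real l \<le> log 2 x + 1"
proof -
  define l where "l = nat \<lceil>log 2 x\<rceil>"
  have pos: "log 2 x > 0" using assms by simp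
  then have l: "log 2 x \<le> real l" "real l \<le> log 2 x + 1"
    unfolding l_def by linarith+
  have "x = 2 powr log 2 x" using assms by simp
  also have "\<dots> \<le> 2 powr real l" using l(1) by (intro powr_mono) auto
  finally have 1: "x \<le> 2 ^ l" by (simp add: powr_realpow)
  have "(2::real) ^ l = 2 powr real l" by (simp add: powr_realpow)
  also have "\<dots> \<le> 2 powr (log 2 x + 1)" using l(2) by (intro powr_mono) auto
  also have "\<dots> = 2 * x" using assms by (simp add: powr_add)
  finally have 2: "2 ^ l \<le> 2 * x" .
  show ?thesis
    by (rule that[OF _ 1 2 l]) (use pos l(1) in linarith)
qed

text \<open>Here \<open>q \<approx> Q powr (1/4 - \<alpha>/3)\<close> and \<open>s \<approx> Q powr (\<alpha>/3)\<close>, so that \<open>(s q)^4 log q \<approx> n\<close>, \<open>q\<^sup>2 / s \<approx> Q powr (1/2 - \<alpha>)\<close>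
  and the redundancy is \<open>n / s\<close> up to constants.\<close>

lemma short_batch_code_small_alpha:
  fixes \<alpha> :: real and n :: nat
  defines "L \<equiv> log 2 (real n)"
  defines "Q \<equiv> real n / L"
  assumes \<alpha>: "0 < \<alpha>" "\<alpha> < 1/4"
    and L: "L \<ge> 2" "L \<ge> 2 * log 2 L" and Q: "Q \<ge> 18 ^ 12"
  shows "\<exists>N\<ge>n. has_batch_code N n (nat \<lfloor>Q powr (1/2 - \<alpha>) / 32\<rfloor>) \<and>
    real N - real n \<le> 175760 * (real n powr (1 - \<alpha>/3) * L powr (\<alpha>/3))"
proof -
  define x where "x = Q powr (1/4 - \<alpha>/3)"
  define Y where "Y = Q powr (\<alpha>/3)"
  define Z where "Z = Q powr (1/2 - \<alpha>)"
  define k where "k = nat \<lfloor>Z / 32\<rfloor>"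
  have Q1: "Q > 1" using Q by (rule less_le_trans[rotated]) simp
  have Lpos: "L > 0" using L by simp
  have n: "real n = Q * L" using Lpos by (simp add: Q_def)
  have npos: "n > 0" using Q1 Lpos n by (cases "n = 0") auto
  have x1: "x > 1" unfolding x_def using Q1 \<alpha> by (intro gr_one_powr) auto
  have Y1: "Y \<ge> 1" unfolding Y_def using Q1 \<alpha> by (intro ge_one_powr_ge_zero) auto
  have pow: "(Q powr a) ^ j = Q powr (a * real j)" for a j
    using Q1 by (subst powr_powr[symmetric], subst powr_realpow) auto
  have xY: "x ^ 4 * Y ^ 4 = Q"
  proof -
    have "x ^ 4 * Y ^ 4 = Q powr ((1/4 - \<alpha>/3) * 4) * Q powr (\<alpha>/3 * 4)"
      by (simp only: x_def Y_def pow of_nat_numeral)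
    also have "\<dots> = Q powr ((1/4 - \<alpha>/3) * 4 + \<alpha>/3 * 4)" by (rule powr_add[symmetric])
    also have "(1/4 - \<alpha>/3) * 4 + \<alpha>/3 * 4 = 1" by simp
    finally show ?thesis using Q1 by simp
  qed
  have x2: "x\<^sup>2 = Z * Y"
  proof -
    have "x\<^sup>2 = Q powr ((1/4 - \<alpha>/3) * 2)"
      by (simp only: x_def pow of_nat_numeral)
    also have "(1/4 - \<alpha>/3) * 2 = (1/2 - \<alpha>) + \<alpha>/3" by simp
    also have "Q powr ((1/2 - \<alpha>) + \<alpha>/3) = Z * Y" by (simp only: Z_def Y_def powr_add)
    finally show ?thesis .
  qed
  \<comment> \<open>Together with \<open>s \<le> 9 * Y\<close> this will give
    \<open>2 * s \<le> q\<close>. The exponents of \<open>x\<close> and \<open>Y\<close> differ by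
    \<open>1/4 - 2 * \<alpha>/3\<close>, which is at least \<open>1/12\<close> because
    \<open>\<alpha> < 1/4\<close>; hence the threshold \<open>18 ^ 12\<close>.\<close>
  have big: "18 * Y \<le> x"
  proof -
    have "(18::real) ^ 12 = 18 powr 12" by simp
    then have "18 = (18 ^ 12 :: real) powr (1/12)"
      by (simp only: powr_powr) simp
    also have "\<dots> \<le> Q powr (1/12)" using Q by (intro powr_mono2) auto
    also have "\<dots> \<le> Q powr (1/4 - \<alpha>/3 - \<alpha>/3)" using Q1 \<alpha> by (intro powr_mono) auto
    finally have "18 * Y \<le> Q powr (1/4 - \<alpha>/3 - \<alpha>/3) * Y"
      using Y1 by (intro mult_right_mono) auto
    also have "\<dots> = x" by (simp add: Y_def x_def powr_add[symmetric])
    finally show ?thesis .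
  qed
  obtain l where l: "l > 0" "x \<le> 2 ^ l" "2 ^ l \<le> 2 * x" "log 2 x \<le> real l" "real l \<le> log 2 x + 1"
    using ex_power_of_two[OF x1] .
  define q :: nat where "q = 2 ^ l"
  have q: "x \<le> real q" "real q \<le> 2 * x" "q > 0" using l by (simp_all add: q_def)
  have logx: "log 2 x = (1/4 - \<alpha>/3) * (L - log 2 L)"
  proof -
    have "log 2 Q = log 2 (real n) - log 2 L"
      unfolding Q_def by (rule log_divide_pos) (use npos Lpos in auto)
    then have "log 2 Q = L - log 2 L"
      by (simp only: L_def)
    then show ?thesis using Q1 by (simp add: x_def log_powr)
  qed
  have logL: "1 \<le> log 2 L"
    using L(1) by (simp add: le_log_iff)
  have l_le: "real l \<le> L"
  proof -
    have "(1/4 - \<alpha>/3) * (L - log 2 L) \<le> 1/4 * (L - log 2 L)"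
      using \<alpha> L logL by (intro mult_right_mono) auto
    then have "log 2 x \<le> 1/4 * (L - log 2 L)" unfolding logx .
    moreover have "d \<le> b" if "a \<le> 1/4 * (b - c)" "d \<le> a + 1" "1 \<le> c" "2 \<le> b" for a b c d :: real
      using that by (simp add: field_simps)
    ultimately show ?thesis using l(5) logL L(1) by blast
  qed
  \<comment> \<open>\<open>1/4 - \<alpha>/3 \<ge> 1/6\<close> and \<open>log 2 L \<le> L/2\<close>
    give \<open>log 2 x \<ge> L/12\<close>.\<close>
  have l_ge: "L / 12 \<le> real l"
  proof -
    have "1/6 * (L - log 2 L) \<le> (1/4 - \<alpha>/3) * (L - log 2 L)"
      using \<alpha> L logL by (intro mult_right_mono) auto
    then have "1/6 * (L - log 2 L) \<le> log 2 x" unfolding logx .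
    moreover have "b / 12 \<le> d" if "1/6 * (b - c) \<le> a" "a \<le> d" "2 * c \<le> b" for a b c d :: real
      using that by (simp add: field_simps)
    ultimately show ?thesis using l(4) L(2) by blast
  qed
  define P where "P s = card (simplex 4 s)" for s
  have ex: "n \<le> P (4 * n) * q ^ 4 * l"
  proof -
    have "n \<le> n ^ 4" using npos by (simp add: self_le_power)
    also have "\<dots> \<le> P (4 * n)" unfolding P_def by (rule card_simplex_ge) simp
    also have "P (4 * n) * 1 \<le> P (4 * n) * (q ^ 4 * l)"
      by (rule mult_le_mono2) (use q(3) l(1) in simp)
    finally show ?thesis by (simp add: mult.assoc)
  qed
  \<comment> \<open>The smallest order whose dimension reaches \<open>n\<close> is taken, so that
    order \<open>s - 1\<close> falls short of \<open>n\<close>; this caps both \<open>s\<close> and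
    the surplus length.\<close>
  define s where "s = (LEAST s. n \<le> P s * q ^ 4 * l)"
  have s: "n \<le> P s * q ^ 4 * l" unfolding s_def by (rule LeastI[of _ "4 * n"]) (rule ex)
  have "P 0 = 0" by (simp add: P_def simplex_def)
  then have spos: "s > 0" using s npos by (cases "s = 0") auto
  have s_min: "P (s - 1) * q ^ 4 * l < n"
    using not_less_Least[of "s - 1" "\<lambda>s. n \<le> P s * q ^ 4 * l"] spos unfolding s_def[symmetric] by simp
  \<comment> \<open>The simplex at \<open>s - 1\<close> contains a cube of side at least
    \<open>(s - 1) / 4\<close>, and \<open>12 \<le> 2 ^ 4\<close> yields
    \<open>s - 1 < 8 * Y\<close>; \<open>Y \<ge> 1\<close> absorbs the 1.\<close>
  have s_le: "real s \<le> 9 * Y"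
  proof -
    have "(real (s - 1) / 4) ^ 4 * (x ^ 4 * (L / 12)) \<le> real (P (s - 1)) * (real q ^ 4 * real l)"
      using card_simplex_ge_real[of "s - 1"] q x1 Lpos l_ge unfolding P_def
      by (intro mult_mono power_mono) auto
    also have "\<dots> = real (P (s - 1) * q ^ 4 * l)" by simp
    also have "\<dots> < real n" using s_min by linarith
    also have "\<dots> = x ^ 4 * Y ^ 4 * L" unfolding n xY ..
    finally have "(real (s - 1) / 4) ^ 4 * (x ^ 4 * L) < 12 * Y ^ 4 * (x ^ 4 * L)"
      by (simp add: field_simps)
    then have "(real (s - 1) / 4) ^ 4 < 12 * Y ^ 4"
      using x1 Lpos by (simp add: mult_less_cancel_right)
    also have "\<dots> \<le> (2 * Y) ^ 4" using Y1 by (simp add: power_mult_distrib)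
    finally have "real (s - 1) / 4 < 2 * Y"
      by (rule power_less_imp_less_base) (use Y1 in simp)
    then show ?thesis using spos Y1 by (simp add: of_nat_diff)
  qed
  have k: "real k \<le> Z / 32"
    unfolding k_def Z_def by (rule of_nat_floor) simp
  have "has_batch_code (q ^ 4 * (P (s + 4) * l)) (P s * q ^ 4 * l) k"
    unfolding P_def q_def
  proof (rule multiplicity_batch_code[OF l(1) spos])
    have "real (2 * s) \<le> real q" using s_le big q(1) by simp
    then show "2 * s \<le> 2 ^ l" unfolding q_def of_nat_le_iff .
    \<comment> \<open>The factor \<open>2 * 9 / 32\<close> is below 1, which is what the 32 in
      \<open>k\<close> provides for.\<close>
    have "real (2 * k * s) \<le> 2 * (Z / 32) * (9 * Y)"
      unfolding of_nat_mult using k s_le by (intro mult_mono) auto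
    also have "\<dots> \<le> Z * Y" using Y1 by (simp add: Z_def)
    also have "\<dots> \<le> real q ^ 2" unfolding x2[symmetric] using q(1) x1 by (intro power_mono) auto
    finally have "real (2 * k * s) \<le> real (q\<^sup>2)" by simp
    then show "2 * k * s \<le> (2 ^ l)\<^sup>2" unfolding q_def of_nat_le_iff .
  qed
  then have code: "has_batch_code (q ^ 4 * (P (s + 4) * l)) n k"
    by (rule batch_code_shorten[OF _ s])
  \<comment> \<open>Only order \<open>s - 1\<close> is known to give dimension below
    \<open>n\<close>, so the count at \<open>s + 4\<close> is compared with it across five
    layers.\<close>
  have P5: "P (s + 4) \<le> P (s - 1) + 5 * (s + 4) ^ 3"
  proof -
    have e: "Suc 3 = (4::nat)" "s - 1 + 5 = s + 4" using spos by auto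
    show ?thesis
      using card_simplex_add_le[of 3 "s - 1" 5] unfolding P_def e .
  qed
  have "P s \<le> P (s + 4)"
    unfolding P_def by (rule card_mono[OF finite_simplex]) (auto simp: simplex_def PiE_def Pi_def intro: less_le_trans)
  then have ge: "n \<le> q ^ 4 * (P (s + 4) * l)"
    using order.trans[OF s, of "P (s + 4) * q ^ 4 * l"] by (simp add: mult_ac)
  have "q ^ 4 * (P (s + 4) * l) \<le> q ^ 4 * ((P (s - 1) + 5 * (s + 4) ^ 3) * l)"
    using P5 by (intro mult_le_mono) auto
  also have "\<dots> = P (s - 1) * q ^ 4 * l + q ^ 4 * (5 * (s + 4) ^ 3 * l)"
    by (simp add: algebra_simps)
  finally have "q ^ 4 * (P (s + 4) * l) \<le> n + q ^ 4 * (5 * (s + 4) ^ 3 * l)"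
    using s_min by linarith
  then have "real (q ^ 4 * (P (s + 4) * l)) \<le> real (n + q ^ 4 * (5 * (s + 4) ^ 3 * l))"
    by (simp only: of_nat_le_iff)
  then have "real (q ^ 4 * (P (s + 4) * l)) - real n \<le> real q ^ 4 * (5 * (real s + 4) ^ 3 * real l)"
    by simp
  \<comment> \<open>\<open>s + 4 \<le> 13 * Y\<close>, and the constant is
    \<open>2 ^ 4 * 5 * 13 ^ 3 = 175760\<close>.\<close>
  also have "\<dots> \<le> (2 * x) ^ 4 * (5 * (13 * Y) ^ 3 * L)"
    using q x1 s_le Y1 l_le by (intro mult_mono power_mono) auto
  also have "\<dots> = 175760 * (x ^ 4 * Y ^ 4 * L / Y)"
  proof -
    have "Y ^ 4 / Y = Y ^ 3" using Y1 by (simp add: power4_eq_xxxx power3_eq_cube)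
    then have "x ^ 4 * Y ^ 4 * L / Y = x ^ 4 * L * Y ^ 3"
      by (metis (no_types, opaque_lifting) mult.assoc mult.commute times_divide_eq_right)
    then show ?thesis by (simp add: power_mult_distrib)
  qed
  also have "x ^ 4 * Y ^ 4 * L / Y = real n / Y"
    by (simp add: xY n)
  also have "real n / Y = real n powr (1 - \<alpha>/3) * L powr (\<alpha>/3)"
  proof -
    have "real n / Y = real n powr 1 * (L powr (\<alpha>/3) / real n powr (\<alpha>/3))"
      using npos Lpos by (simp add: Y_def Q_def powr_divide)
    also have "\<dots> = real n powr (1 - \<alpha>/3) * L powr (\<alpha>/3)"
      by (simp only: powr_diff) simp
    finally show ?thesis .
  qed
  finally show ?thesis
    using code ge unfolding k_def Z_def by blast
qed

text \<open>With \<open>q\<close> about \<open>n powr (1/3)\<close> the redundancy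
  \<open>d * q^2\<close> is at most \<open>4 * n powr (7/6 - \<alpha>)\<close>, and
  \<open>7/6 - \<alpha> \<le> 1 - \<alpha>/3\<close> means \<open>\<alpha> \<ge> 1/4\<close>. The
  query count and the constant are those of the other range, so that both can be merged.\<close>

lemma short_batch_code_large_alpha:
  fixes \<alpha> :: real and n :: nat
  defines "L \<equiv> log 2 (real n)"
  defines "Q \<equiv> real n / L"
  assumes \<alpha>: "1/4 \<le> \<alpha>" "\<alpha> < 1/2" and L: "L \<ge> 2"
  shows "\<exists>N\<ge>n. has_batch_code N n (nat \<lfloor>Q powr (1/2 - \<alpha>) / 32\<rfloor>) \<and>
    real N - real n \<le> 175760 * (real n powr (1 - \<alpha>/3) * L powr (\<alpha>/3))"
proof -
  have n1: "real n > 1"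
  proof (rule ccontr)
    assume "\<not> real n > 1"
    then have "n = 0 \<or> n = 1" by auto
    then have "L = 0" by (auto simp: L_def log_def)
    then show False using L by simp
  qed
  define d where "d = nat \<lfloor>Q powr (1/2 - \<alpha>) / 32\<rfloor>"
  have Qn: "Q \<le> real n" "Q > 0" using L n1 by (auto simp: Q_def field_simps)
  have "real d \<le> Q powr (1/2 - \<alpha>) / 32"
    unfolding d_def by (rule of_nat_floor) simp
  also have "\<dots> \<le> Q powr (1/2 - \<alpha>)" by simp
  also have "\<dots> \<le> real n powr (1/2 - \<alpha>)"
    using Qn \<alpha> by (intro powr_mono2) auto
  finally have d: "real d \<le> real n powr (1/2 - \<alpha>)" .
  have "real n powr (1/3) > 1" using n1 by (intro gr_one_powr) auto
  then obtain l where l: "l > 0" "real n powr (1/3) \<le> 2 ^ l" "2 ^ l \<le> 2 * real n powr (1/3)"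
    using ex_power_of_two by blast
  have cube: "(real n powr (1/3)) ^ 3 = real n"
    using n1 by (simp add: powr_realpow[symmetric] powr_powr)
  have sq: "(real n powr (1/3))\<^sup>2 = real n powr (2/3)"
    using n1 by (simp add: powr_realpow[symmetric] powr_powr)
  have "real n \<le> (2 ^ l) ^ 3"
    using power_mono[OF l(2), of 3] unfolding cube by simp
  then have "real n \<le> real ((2 ^ l) ^ 3)" by simp
  then have h1: "n \<le> (2 ^ l) ^ 3" unfolding of_nat_le_iff .
  have "real d \<le> real n powr (1/3)"
    using d \<alpha> n1 by (elim order.trans) (intro powr_mono, auto)
  then have "real d \<le> real (2 ^ l)"
    unfolding of_nat_power of_nat_numeral using l(2) by (rule order.trans)
  then have h2: "d \<le> 2 ^ l" unfolding of_nat_le_iff .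
  have "real (n + d * (2 ^ l)\<^sup>2) - real n = real d * (2 ^ l)\<^sup>2" by simp
  also have "\<dots> \<le> real n powr (1/2 - \<alpha>) * (2 * real n powr (1/3))\<^sup>2"
    using d l by (intro mult_mono power_mono) auto
  also have "\<dots> = 4 * (real n powr (1/2 - \<alpha>) * real n powr (2/3))"
    by (simp add: power_mult_distrib sq)
  also have "\<dots> = 4 * real n powr (1/2 - \<alpha> + 2/3)"
    by (simp only: powr_add)
  also have "\<dots> \<le> 4 * real n powr (1 - \<alpha>/3)"
    using n1 \<alpha> by (intro mult_left_mono powr_mono) auto
  also have "\<dots> \<le> 175760 * (real n powr (1 - \<alpha>/3) * L powr (\<alpha>/3))"
  proof -
    have "L powr (\<alpha>/3) \<ge> 1" using L \<alpha> by (intro ge_one_powr_ge_zero) auto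
    then have "real n powr (1 - \<alpha>/3) * 1 \<le> real n powr (1 - \<alpha>/3) * L powr (\<alpha>/3)"
      by (intro mult_left_mono) auto
    then have "175760 * real n powr (1 - \<alpha>/3) \<le> 175760 * (real n powr (1 - \<alpha>/3) * L powr (\<alpha>/3))"
      by (intro mult_left_mono) auto
    moreover have "4 * real n powr (1 - \<alpha>/3) \<le> 175760 * real n powr (1 - \<alpha>/3)" by simp
    ultimately show ?thesis by (rule order.trans[rotated])
  qed
  finally have "real (n + d * (2 ^ l)\<^sup>2) - real n \<le> 175760 * (real n powr (1 - \<alpha>/3) * L powr (\<alpha>/3))" .
  then show ?thesis
    using conic_batch_code[OF l(1) h1 h2] unfolding d_def by (intro exI[of _ "n + d * (2 ^ l)\<^sup>2"]) (simp add: d_def)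
qed

section \<open>Families of codes and their asymptotics\<close>

lemma eventually_short_batch_code:
  fixes \<alpha> :: real
  assumes "0 < \<alpha>" "\<alpha> < 1/2"
  shows "\<forall>\<^sub>F n in at_top. \<exists>N\<ge>n.
    has_batch_code N n (nat \<lfloor>(real n / log 2 (real n)) powr (1/2 - \<alpha>) / 32\<rfloor>) \<and>
    real N - real n \<le> 175760 * (real n powr (1 - \<alpha>/3) * log 2 (real n) powr (\<alpha>/3))"
proof -
  have "\<forall>\<^sub>F n in at_top. log 2 (real n) \<ge> 2" by real_asymp
  moreover have "\<forall>\<^sub>F n in at_top. log 2 (real n) \<ge> 2 * log 2 (log 2 (real n))" by real_asymp
  moreover have "\<forall>\<^sub>F n in at_top. real n / log 2 (real n) \<ge> 18 ^ 12" by real_asymp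
  ultimately show ?thesis
  proof eventually_elim
    case (elim n)
    show ?case
    proof (cases "\<alpha> < 1/4")
      case True
      then show ?thesis using short_batch_code_small_alpha[OF assms(1)] elim by blast
    next
      case False
      then show ?thesis using short_batch_code_large_alpha[OF _ assms(2)] elim by simp
    qed
  qed
qed

text \<open>Dividing by \<open>c\<close> costs only a constant, and rounding down at most halves the
  quotient once it is at least 2.\<close>

lemma floor_bigtheta:
  fixes f :: "nat \<Rightarrow> real"
  assumes f: "filterlim f at_top at_top" and c: "c > 0"
  shows "(\<lambda>n. real (nat \<lfloor>f n / c\<rfloor>)) \<in> \<Theta>(f)"
proof (rule bigthetaI)
  show "(\<lambda>n. real (nat \<lfloor>f n / c\<rfloor>)) \<in> O(f)"
  proof (rule bigoI)
    have "\<forall>\<^sub>F n in at_top. f n \<ge> 0" using f by (simp add: filterlim_at_top)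
    then show "\<forall>\<^sub>F n in at_top. norm (real (nat \<lfloor>f n / c\<rfloor>)) \<le> (1 / c) * norm (f n)"
    proof eventually_elim
      case (elim n)
      then have "real (nat \<lfloor>f n / c\<rfloor>) \<le> f n / c" using c by (intro of_nat_floor) simp
      then show ?case using elim by simp
    qed
  qed
  show "(\<lambda>n. real (nat \<lfloor>f n / c\<rfloor>)) \<in> \<Omega>(f)"
  proof (rule landau_omega.bigI[of "1 / (2 * c)"])
    have "\<forall>\<^sub>F n in at_top. f n \<ge> 2 * c" using f by (simp add: filterlim_at_top)
    then show "\<forall>\<^sub>F n in at_top. 1 / (2 * c) * norm (f n) \<le> norm (real (nat \<lfloor>f n / c\<rfloor>))"
    proof eventually_elim
      case (elim n)
      have "f n / c \<ge> 2" using elim c by (simp add: field_simps)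
      then have "f n / c / 2 \<le> f n / c - 1" by (simp add: field_simps)
      also have "\<dots> \<le> real (nat \<lfloor>f n / c\<rfloor>)" by linarith
      finally have "f n / c / 2 \<le> real (nat \<lfloor>f n / c\<rfloor>)" .
      moreover have "norm (f n) = f n" using elim c by simp
      ultimately show ?case by (simp add: field_simps)
    qed
  qed (use c in simp)
qed

text \<open>A length is chosen for each \<open>n\<close>; \<open>N \<ge> n\<close> makes the
  redundancy nonnegative, so the one-sided bound is a bound on its absolute value.\<close>

lemma ex_batch_code_function:
  assumes "\<forall>\<^sub>F n in at_top. \<exists>N\<ge>n. has_batch_code N n (kf n) \<and> real N - real n \<le> C * B n"
    and "\<And>n. B n \<ge> 0"
  obtains Nf :: "nat \<Rightarrow> nat" where "\<forall>\<^sub>F n in at_top. has_batch_code (Nf n) n (kf n)"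
    "(\<lambda>n. real (Nf n) - real n) \<in> O(B)"
proof -
  obtain Nf where Nf: "\<forall>\<^sub>F n in at_top. Nf n \<ge> n \<and> has_batch_code (Nf n) n (kf n) \<and> real (Nf n) - real n \<le> C * B n"
    using assms(1) unfolding eventually_ex by blast
  show ?thesis
  proof (rule that)
    show "\<forall>\<^sub>F n in at_top. has_batch_code (Nf n) n (kf n)"
      using Nf by eventually_elim simp
    show "(\<lambda>n. real (Nf n) - real n) \<in> O(B)"
      by (rule bigoI[of _ C], use Nf in eventually_elim) (use assms(2) in simp)
  qed
qed

text \<open>The multiplicity code with \<open>s = 1\<close> and \<open>q\<close> about
  \<open>n powr (1/4)\<close> serves at least \<open>n powr (1/2) / 2\<close> queries with length of
  order \<open>n * log 2 n\<close>. About \<open>n powr (\<epsilon> - 1/2)\<close> copies then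
  suffice. The factor 48 is \<open>3 * 2 ^ 4\<close>, from \<open>r \<le> 3 * w\<close> and
  \<open>q \<le> 2 * x\<close>.\<close>

lemma long_batch_code:
  fixes \<epsilon> :: real and n :: nat
  assumes \<epsilon>: "\<epsilon> \<ge> 1/2" and n: "n \<ge> 16"
  shows "\<exists>N. has_batch_code N n (nat \<lfloor>real n powr \<epsilon>\<rfloor>) \<and>
    real N \<le> 48 * real (card (simplex 4 5)) * (real n powr (1/2 + \<epsilon>) * log 2 (real n))"
proof -
  define x where "x = real n powr (1/4)"
  define y where "y = real n powr (1/2)"
  have n1: "real n > 1" using n by simp
  have x1: "x > 1" unfolding x_def using n1 by (intro gr_one_powr) auto
  have x2: "x\<^sup>2 = y" and x4: "x ^ 4 = real n"
    using n1 by (simp_all add: x_def y_def powr_realpow[symmetric] powr_powr)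
  obtain l where l: "l > 0" "x \<le> 2 ^ l" "2 ^ l \<le> 2 * x" "real l \<le> log 2 x + 1"
    using ex_power_of_two[OF x1] by blast
  have lL: "real l \<le> log 2 (real n)"
  proof -
    have "4 = log 2 (2 ^ 4 :: real)" by (subst log_nat_power) simp_all
    also have "\<dots> \<le> log 2 (real n)" using n by (subst log_le_cancel_iff) auto
    finally show ?thesis using l(4) n1 by (simp add: x_def log_powr)
  qed
  define q :: nat where "q = 2 ^ l"
  define k0 where "k0 = q\<^sup>2 div 2"
  define P where "P s = card (simplex 4 s)" for s
  have even: "even (q\<^sup>2)" using l(1) by (simp add: q_def)
  then have k0: "2 * k0 = q\<^sup>2" by (simp add: k0_def)
  have q: "x \<le> real q" "real q \<le> 2 * x" using l by (simp_all add: q_def)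
  have k0_ge: "y / 2 \<le> real k0"
  proof -
    have "y \<le> real q ^ 2" unfolding x2[symmetric] using q(1) x1 by (intro power_mono) auto
    also have "\<dots> = 2 * real k0" using k0 by (metis of_nat_mult of_nat_numeral of_nat_power)
    finally show ?thesis by simp
  qed
  have y1: "y \<ge> 1" unfolding y_def using n1 by (intro ge_one_powr_ge_zero) auto
  have k0pos: "k0 > 0" using k0_ge y1 by (cases "k0 = 0") auto
  have "has_batch_code (q ^ 4 * (P (1 + 4) * l)) (P 1 * q ^ 4 * l) k0"
    unfolding P_def q_def
  proof (rule multiplicity_batch_code[OF l(1)])
    show "2 * 1 \<le> (2::nat) ^ l" using l(1) self_le_power[of "2::nat" l] by simp
    show "2 * k0 * 1 \<le> (2 ^ l)\<^sup>2" using k0 by (simp add: q_def)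
  qed simp
  moreover have "n \<le> P 1 * q ^ 4 * l"
  proof -
    have "real n \<le> real q ^ 4" unfolding x4[symmetric] using q(1) x1 by (intro power_mono) auto
    then have "real n \<le> real (q ^ 4)" by simp
    then have "n \<le> q ^ 4" unfolding of_nat_le_iff .
    also have "\<dots> \<le> P 1 * q ^ 4 * l"
      using card_simplex_ge[of 1 1] l(1) by (simp add: P_def)
    finally show ?thesis .
  qed
  ultimately have "has_batch_code (q ^ 4 * (P (1 + 4) * l)) n k0"
    by (rule batch_code_shorten)
  then have code0: "has_batch_code (q ^ 4 * (P 5 * l)) n k0" by simp
  define k where "k = nat \<lfloor>real n powr \<epsilon>\<rfloor>"
  define r where "r = k div k0 + 1"
  have "k < r * k0"
    unfolding r_def distrib_right using mod_less_divisor[OF k0pos, of k] div_mult_mod_eq[of k k0] by linarith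
  then have code: "has_batch_code (r * (q ^ 4 * (P 5 * l))) n k"
    by (intro batch_code_fewer_queries[OF batch_code_repeat[OF code0]] less_imp_le)
  define w where "w = real n powr (\<epsilon> - 1/2)"
  have w1: "w \<ge> 1" unfolding w_def using n1 \<epsilon> by (intro ge_one_powr_ge_zero) auto
  have yw: "y * w = real n powr \<epsilon>" by (simp add: y_def w_def powr_add[symmetric])
  have r_le: "real r \<le> 3 * w"
  proof -
    have "real (k div k0) \<le> real k / real k0" by (rule of_nat_div_le_of_nat)
    also have "\<dots> \<le> (y * w) / (y / 2)"
      unfolding yw k_def using k0_ge y1 by (intro frac_le of_nat_floor) auto
    also have "\<dots> = 2 * w" using y1 by simp
    finally show ?thesis unfolding r_def using w1 by simp
  qed
  have "real (r * (q ^ 4 * (P 5 * l))) = real r * (real q ^ 4 * (real (P 5) * real l))" by simp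
  also have "\<dots> \<le> (3 * w) * ((2 * x) ^ 4 * (real (P 5) * log 2 (real n)))"
    using r_le q(2) lL x1 w1 by (intro mult_mono power_mono mult_nonneg_nonneg) auto
  also have "\<dots> = 48 * real (P 5) * (w * real n * log 2 (real n))"
    by (simp add: power_mult_distrib x4)
  also have "w * real n = real n powr (1/2 + \<epsilon>)"
  proof -
    have "w * real n = real n powr (\<epsilon> - 1/2) * real n powr 1" using n1 by (simp add: w_def)
    also have "\<dots> = real n powr (\<epsilon> - 1/2 + 1)" by (rule powr_add[symmetric])
    finally show ?thesis by (simp add: add.commute)
  qed
  finally show ?thesis
    using code unfolding k_def P_def by blast
qed

theorem theorem7:
  shows
  "(\<forall>\<alpha>::real. 0 < \<alpha> \<and> \<alpha> < 1/2 \<longrightarrow>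
      (\<exists>kf Nf :: nat \<Rightarrow> nat.
         (\<forall>\<^sub>F n in at_top. has_batch_code (Nf n) n (kf n)) \<and>
         (\<lambda>n. real (kf n)) \<in> \<Theta>(\<lambda>n. (real n / log 2 (real n)) powr (1/2 - \<alpha>)) \<and>
         (\<lambda>n. real (Nf n) - real n) \<in>
            O(\<lambda>n. real n powr (1 - \<alpha>/3) * (log 2 (real n)) powr (\<alpha>/3))))
   \<and>
   (\<forall>\<epsilon>::real. 0 < \<epsilon> \<and> \<epsilon> < 1/2 \<longrightarrow>
      (\<exists>kf Nf :: nat \<Rightarrow> nat.
         (\<forall>\<^sub>F n in at_top. has_batch_code (Nf n) n (kf n)) \<and>
         (\<forall>\<tau>>0. (\<lambda>n. real (kf n)) \<in> \<Omega>(\<lambda>n. real n powr (\<epsilon> - \<tau>))) \<and>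
         (\<forall>\<tau>>0. (\<lambda>n. real (Nf n) - real n) \<in> O(\<lambda>n. real n powr (5/6 + \<epsilon>/3 + \<tau>))))
      \<and>
      (\<exists>kf Nf :: nat \<Rightarrow> nat.
         (\<forall>\<^sub>F n in at_top. has_batch_code (Nf n) n (kf n)) \<and>
         (\<lambda>n. real (kf n)) \<in> \<Theta>(\<lambda>n. real n powr \<epsilon>) \<and>
         (\<lambda>n. real (Nf n) - real n) \<in> o(\<lambda>n. real n)))
   \<and>
   (\<forall>\<epsilon>::real. \<epsilon> \<ge> 1/2 \<longrightarrow>
      (\<exists>kf Nf :: nat \<Rightarrow> nat.
         (\<forall>\<^sub>F n in at_top. has_batch_code (Nf n) n (kf n)) \<and>
         (\<lambda>n. real (kf n)) \<in> \<Theta>(\<lambda>n. real n powr \<epsilon>) \<and>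
         (\<forall>\<tau>>0. (\<lambda>n. real (Nf n)) \<in> O(\<lambda>n. real n powr (1/2 + \<epsilon> + \<tau>)))))"
proof (intro conjI allI impI)
  fix \<alpha> :: real assume "0 < \<alpha> \<and> \<alpha> < 1/2"
  then have \<alpha>: "0 < \<alpha>" "\<alpha> < 1/2" by auto
  let ?k = "\<lambda>n. nat \<lfloor>(real n / log 2 (real n)) powr (1/2 - \<alpha>) / 32\<rfloor>"
  obtain Nf where Nf: "\<forall>\<^sub>F n in at_top. has_batch_code (Nf n) n (?k n)"
    "(\<lambda>n. real (Nf n) - real n) \<in> O(\<lambda>n. real n powr (1 - \<alpha>/3) * log 2 (real n) powr (\<alpha>/3))"
    by (rule ex_batch_code_function[OF eventually_short_batch_code[OF \<alpha>]]) simp_all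
  have "filterlim (\<lambda>n. (real n / log 2 (real n)) powr (1/2 - \<alpha>)) at_top at_top"
    using \<alpha> by real_asymp
  then have \<Theta>: "(\<lambda>n. real (?k n)) \<in> \<Theta>(\<lambda>n. (real n / log 2 (real n)) powr (1/2 - \<alpha>))"
    by (rule floor_bigtheta) simp
  show "\<exists>kf Nf :: nat \<Rightarrow> nat.
         (\<forall>\<^sub>F n in at_top. has_batch_code (Nf n) n (kf n)) \<and>
         (\<lambda>n. real (kf n)) \<in> \<Theta>(\<lambda>n. (real n / log 2 (real n)) powr (1/2 - \<alpha>)) \<and>
         (\<lambda>n. real (Nf n) - real n) \<in>
            O(\<lambda>n. real n powr (1 - \<alpha>/3) * (log 2 (real n)) powr (\<alpha>/3))"
    by (rule exI[of _ ?k], rule exI[of _ Nf]) (intro conjI Nf \<Theta>)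
next
  fix \<epsilon> :: real assume "0 < \<epsilon> \<and> \<epsilon> < 1/2"
  then have \<epsilon>: "0 < \<epsilon>" "\<epsilon> < 1/2" by auto
  \<comment> \<open>With this choice \<open>1 - \<alpha>/3 = 5/6 + \<epsilon>/3\<close>, and
    \<open>\<tau>\<close> absorbs all powers of the logarithm.\<close>
  define \<alpha> where "\<alpha> = 1/2 - \<epsilon>"
  have \<alpha>: "0 < \<alpha>" "\<alpha> < 1/2" using \<epsilon> by (auto simp: \<alpha>_def)
  let ?k = "\<lambda>n. nat \<lfloor>(real n / log 2 (real n)) powr (1/2 - \<alpha>) / 32\<rfloor>"
  obtain Nf where Nf: "\<forall>\<^sub>F n in at_top. has_batch_code (Nf n) n (?k n)"
    "(\<lambda>n. real (Nf n) - real n) \<in> O(\<lambda>n. real n powr (1 - \<alpha>/3) * log 2 (real n) powr (\<alpha>/3))"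
    by (rule ex_batch_code_function[OF eventually_short_batch_code[OF \<alpha>]]) simp_all
  have \<Omega>: "(\<lambda>n. real (?k n)) \<in> \<Omega>(\<lambda>n. real n powr (\<epsilon> - \<tau>))" if "\<tau> > 0" for \<tau>
  proof -
    have "filterlim (\<lambda>n. (real n / log 2 (real n)) powr (1/2 - \<alpha>)) at_top at_top"
      using \<alpha> by real_asymp
    then have "(\<lambda>n. real (?k n)) \<in> \<Omega>(\<lambda>n. (real n / log 2 (real n)) powr (1/2 - \<alpha>))"
      by (rule bigthetaD2[OF floor_bigtheta]) simp
    also have "1/2 - \<alpha> = \<epsilon>" by (simp add: \<alpha>_def)
    also have "(\<lambda>n. (real n / log 2 (real n)) powr \<epsilon>) \<in> \<Omega>(\<lambda>n. real n powr (\<epsilon> - \<tau>))"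
      using \<epsilon> that by real_asymp
    finally show ?thesis by (simp add: \<alpha>_def)
  qed
  have O: "(\<lambda>n. real (Nf n) - real n) \<in> O(\<lambda>n. real n powr (5/6 + \<epsilon>/3 + \<tau>))" if "\<tau> > 0" for \<tau>
  proof -
    note Nf(2)
    also have "1 - \<alpha>/3 = 5/6 + \<epsilon>/3" by (simp add: \<alpha>_def field_simps)
    also have "(\<lambda>n. real n powr (5/6 + \<epsilon>/3) * log 2 (real n) powr (\<alpha>/3)) \<in> O(\<lambda>n. real n powr (5/6 + \<epsilon>/3 + \<tau>))"
      using \<alpha> that by real_asymp
    finally show ?thesis .
  qed
  show "\<exists>kf Nf :: nat \<Rightarrow> nat.
         (\<forall>\<^sub>F n in at_top. has_batch_code (Nf n) n (kf n)) \<and>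
         (\<forall>\<tau>>0. (\<lambda>n. real (kf n)) \<in> \<Omega>(\<lambda>n. real n powr (\<epsilon> - \<tau>))) \<and>
         (\<forall>\<tau>>0. (\<lambda>n. real (Nf n) - real n) \<in> O(\<lambda>n. real n powr (5/6 + \<epsilon>/3 + \<tau>)))"
    by (rule exI[of _ ?k], rule exI[of _ Nf]) (intro conjI allI impI Nf(1) \<Omega> O)
next
  fix \<epsilon> :: real assume "0 < \<epsilon> \<and> \<epsilon> < 1/2"
  then have \<epsilon>: "0 < \<epsilon>" "\<epsilon> < 1/2" by auto
  \<comment> \<open>Halving leaves \<open>1/2 - \<alpha> > \<epsilon>\<close>, a polynomial margin
    that covers the logarithm and the constant 32 for large \<open>n\<close>, while
    \<open>\<alpha> > 0\<close> keeps the redundancy in \<open>o(n)\<close>.\<close>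
  define \<alpha> where "\<alpha> = (1/2 - \<epsilon>) / 2"
  have \<alpha>: "0 < \<alpha>" "\<alpha> < 1/2" and \<epsilon>\<alpha>: "\<epsilon> < 1/2 - \<alpha>" using \<epsilon> by (auto simp: \<alpha>_def field_simps)
  let ?k = "\<lambda>n. nat \<lfloor>real n powr \<epsilon> / 1\<rfloor>"
  have "\<forall>\<^sub>F n in at_top. real n powr \<epsilon> \<le> (real n / log 2 (real n)) powr (1/2 - \<alpha>) / 32"
    using \<epsilon>\<alpha> \<epsilon>(1) by real_asymp
  with eventually_short_batch_code[OF \<alpha>]
  have "\<forall>\<^sub>F n in at_top. \<exists>N\<ge>n. has_batch_code N n (?k n) \<and>
      real N - real n \<le> 175760 * (real n powr (1 - \<alpha>/3) * log 2 (real n) powr (\<alpha>/3))"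
  proof eventually_elim
    case (elim n)
    then obtain N where N: "N \<ge> n" "has_batch_code N n (nat \<lfloor>(real n / log 2 (real n)) powr (1/2 - \<alpha>) / 32\<rfloor>)"
      "real N - real n \<le> 175760 * (real n powr (1 - \<alpha>/3) * log 2 (real n) powr (\<alpha>/3))"
      by blast
    have "?k n \<le> nat \<lfloor>(real n / log 2 (real n)) powr (1/2 - \<alpha>) / 32\<rfloor>"
      using elim(2) by (intro nat_mono floor_mono) simp
    then show ?case
      using N batch_code_fewer_queries[OF N(2)] by blast
  qed
  then obtain Nf where Nf: "\<forall>\<^sub>F n in at_top. has_batch_code (Nf n) n (?k n)"
    "(\<lambda>n. real (Nf n) - real n) \<in> O(\<lambda>n. real n powr (1 - \<alpha>/3) * log 2 (real n) powr (\<alpha>/3))"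
    by (rule ex_batch_code_function) simp_all
  note Nf(2)
  also have "(\<lambda>n. real n powr (1 - \<alpha>/3) * log 2 (real n) powr (\<alpha>/3)) \<in> o(\<lambda>n. real n)"
    using \<alpha> by real_asymp
  finally have o: "(\<lambda>n. real (Nf n) - real n) \<in> o(\<lambda>n. real n)" .
  have "filterlim (\<lambda>n. real n powr \<epsilon>) at_top at_top"
    using \<epsilon> by real_asymp
  then have \<Theta>: "(\<lambda>n. real (?k n)) \<in> \<Theta>(\<lambda>n. real n powr \<epsilon>)"
    by (rule floor_bigtheta) simp
  show "\<exists>kf Nf :: nat \<Rightarrow> nat.
         (\<forall>\<^sub>F n in at_top. has_batch_code (Nf n) n (kf n)) \<and>
         (\<lambda>n. real (kf n)) \<in> \<Theta>(\<lambda>n. real n powr \<epsilon>) \<and>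
         (\<lambda>n. real (Nf n) - real n) \<in> o(\<lambda>n. real n)"
    by (rule exI[of _ ?k], rule exI[of _ Nf]) (intro conjI Nf(1) \<Theta> o)
next
  fix \<epsilon> :: real assume \<epsilon>: "\<epsilon> \<ge> 1/2"
  let ?k = "\<lambda>n. nat \<lfloor>real n powr \<epsilon> / 1\<rfloor>"
  let ?C = "48 * real (card (simplex 4 5))"
  have "\<forall>\<^sub>F n in at_top. \<exists>N. has_batch_code N n (?k n) \<and>
      real N \<le> ?C * (real n powr (1/2 + \<epsilon>) * log 2 (real n))"
    using eventually_ge_at_top[of "16::nat"]
    by eventually_elim (use long_batch_code[OF \<epsilon>] in simp)
  then obtain Nf where Nf: "\<forall>\<^sub>F n in at_top. has_batch_code (Nf n) n (?k n) \<and>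
      real (Nf n) \<le> ?C * (real n powr (1/2 + \<epsilon>) * log 2 (real n))"
    unfolding eventually_ex by blast
  have O: "(\<lambda>n. real (Nf n)) \<in> O(\<lambda>n. real n powr (1/2 + \<epsilon>) * log 2 (real n))"
  proof (rule bigoI[of _ ?C])
    show "\<forall>\<^sub>F n in at_top. norm (real (Nf n)) \<le> ?C * norm (real n powr (1/2 + \<epsilon>) * log 2 (real n))"
      using Nf eventually_ge_at_top[of 1] by eventually_elim simp
  qed
  have O': "(\<lambda>n. real (Nf n)) \<in> O(\<lambda>n. real n powr (1/2 + \<epsilon> + \<tau>))" if "\<tau> > 0" for \<tau>
  proof -
    note O
    also have "(\<lambda>n. real n powr (1/2 + \<epsilon>) * log 2 (real n)) \<in> O(\<lambda>n. real n powr (1/2 + \<epsilon> + \<tau>))"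
      using that by real_asymp
    finally show ?thesis .
  qed
  have "filterlim (\<lambda>n. real n powr \<epsilon>) at_top at_top"
    using \<epsilon> by real_asymp
  then have \<Theta>: "(\<lambda>n. real (?k n)) \<in> \<Theta>(\<lambda>n. real n powr \<epsilon>)"
    by (rule floor_bigtheta) simp
  have code: "\<forall>\<^sub>F n in at_top. has_batch_code (Nf n) n (?k n)"
    using Nf by eventually_elim simp
  show "\<exists>kf Nf :: nat \<Rightarrow> nat.
         (\<forall>\<^sub>F n in at_top. has_batch_code (Nf n) n (kf n)) \<and>
         (\<lambda>n. real (kf n)) \<in> \<Theta>(\<lambda>n. real n powr \<epsilon>) \<and>
         (\<forall>\<tau>>0. (\<lambda>n. real (Nf n)) \<in> O(\<lambda>n. real n powr (1/2 + \<epsilon> + \<tau>)))"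
    by (rule exI[of _ ?k], rule exI[of _ Nf]) (intro conjI allI impI code \<Theta> O')
qed

end
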